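(* Let $1<p<\infty$, $\frac1p+\frac1q=1$, let $a,b$ be as in the context, and let $w=(w_n)_{n\ge0}$ be a sequence of nonzero complex numbers with $$\sup_{n\ge0}\Big|\frac{w_na_n}{a_{n+1}}\Big|<\infty\quad\text{and}\quad\limsup_{n\to\infty}\Big|\frac{b_n}{a_{n+1}}\Big|<1$$ (so $F_w$ is bounded on $\ell^p_{a,b}$). Consider the statements: (i) $F_w^*$ is chaotic on $(\ell^p_{a,b})^*$; (ii) $F_w^*$ has a nonzero periodic vector; (iii) $\sum_{n=1}^{\infty}\Big|\frac{a_n}{w_0w_1\cdots w_{n-1}}\Big|^q<\infty$. Then (iii) $\Rightarrow$ (i) $\Rightarrow$ (ii). If in addition $$\sum_{n\ge0}\Big(\sum_{j\ge1}\Big|\prod_{k=1}^{j}\frac{b_{n+k-1}}{a_{n+k}}\Big|^p\Big)^{q/p}<\infty,$$ then (ii) $\Rightarrow$ (iii), so all three statements are equivalent.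
   Context: Let $a=(a_n)_{n\ge0}$, $b=(b_n)_{n\ge0}$ be sequences of nonzero complex numbers with $\limsup_{n\to\infty}(|a_n|+|b_n|)^{1/n}<\infty$, and let $R=1/\limsup_{n}(|a_n|+|b_n|)^{1/n}\in(0,\infty]$. For $n\ge0$ let $f_n(z)=(a_n+b_nz)z^n$. For $1\le p<\infty$, $\ell^p_{a,b}$ is the space of analytic functions on $\{|z|<R\}$ of the form $f=\sum_{n\ge0}\lambda_nf_n$ with $(\lambda_n)\in\ell^p(\mathbb{N}_0)$ (the series converges locally uniformly on $\{|z|<R\}$ and the $\lambda_n$ are uniquely determined by $f$), normed by $\|f\|=(\sum_n|\lambda_n|^p)^{1/p}$. For a sequence $w=(w_n)_{n\ge0}$, the weighted forward shift is $F_w\big(\sum_{n\ge0}\mu_nz^n\big)=\sum_{n\ge0}\mu_nw_nz^{n+1}$; $F_w^*$ is its Banach space adjoint. A vector $v$ is periodic for $T$ if $T^mv=v$ for some $m\ge1$. An operator on a separable Banach space is chaotic if it is hypercyclic (has a dense orbit) and its set of periodic vectors is dense. *)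

theory Defs
  imports "HOL-Analysis.Analysis" "HOL-Library.Liminf_Limsup"
begin

definition fab :: "(nat \<Rightarrow> complex) \<Rightarrow> (nat \<Rightarrow> complex) \<Rightarrow> nat \<Rightarrow> complex \<Rightarrow> complex" where
  "fab a b n z = (a n + b n * z) * z ^ n"

text \<open>R = 1 / limsup (|a_n|+|b_n|)^(1/n), as an extended real (R = infinity if the limsup is 0).\<close>
definition radius_ab :: "(nat \<Rightarrow> complex) \<Rightarrow> (nat \<Rightarrow> complex) \<Rightarrow> ereal" where
  "radius_ab a b = inverse (limsup (\<lambda>n. ereal ((norm (a n) + norm (b n)) powr (1 / real n))))"

definition in_lp :: "real \<Rightarrow> (nat \<Rightarrow> complex) \<Rightarrow> bool" where
  "in_lp p l \<longleftrightarrow> summable (\<lambda>n. norm (l n) powr p)"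

text \<open>Elements of l^p_{a,b}: functions on the disc |z| < R, extended by 0 outside the disc.\<close>
definition lab :: "(nat \<Rightarrow> complex) \<Rightarrow> (nat \<Rightarrow> complex) \<Rightarrow> real \<Rightarrow> (complex \<Rightarrow> complex) set" where
  "lab a b p = {f. \<exists>l. in_lp p l \<and>
      (\<forall>z. f z = (if ereal (norm z) < radius_ab a b then (\<Sum>n. l n * fab a b n z) else 0))}"

definition lab_coeffs :: "(nat \<Rightarrow> complex) \<Rightarrow> (nat \<Rightarrow> complex) \<Rightarrow> real \<Rightarrow> (complex \<Rightarrow> complex) \<Rightarrow> nat \<Rightarrow> complex" where
  "lab_coeffs a b p f = (THE l. in_lp p l \<and>
      (\<forall>z. ereal (norm z) < radius_ab a b \<longrightarrow> f z = (\<Sum>n. l n * fab a b n z)))"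

definition lab_norm :: "(nat \<Rightarrow> complex) \<Rightarrow> (nat \<Rightarrow> complex) \<Rightarrow> real \<Rightarrow> (complex \<Rightarrow> complex) \<Rightarrow> real" where
  "lab_norm a b p f = (\<Sum>n. norm (lab_coeffs a b p f n) powr p) powr (1 / p)"

definition taylor_coeff :: "(complex \<Rightarrow> complex) \<Rightarrow> nat \<Rightarrow> complex" where
  "taylor_coeff f n = (deriv ^^ n) f 0 / of_nat (fact n)"

definition fwd_shift :: "(nat \<Rightarrow> complex) \<Rightarrow> (nat \<Rightarrow> complex) \<Rightarrow> (nat \<Rightarrow> complex) \<Rightarrow> (complex \<Rightarrow> complex) \<Rightarrow> complex \<Rightarrow> complex" where
  "fwd_shift a b w f z = (if ereal (norm z) < radius_ab a b
      then (\<Sum>n. taylor_coeff f n * w n * z ^ Suc n) else 0)"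

text \<open>The dual space: bounded linear functionals on l^p_{a,b} (normalised to be 0 off the space).\<close>
definition lab_dual :: "(nat \<Rightarrow> complex) \<Rightarrow> (nat \<Rightarrow> complex) \<Rightarrow> real \<Rightarrow> ((complex \<Rightarrow> complex) \<Rightarrow> complex) set" where
  "lab_dual a b p = {\<phi>.
      (\<forall>f\<in>lab a b p. \<forall>g\<in>lab a b p. \<phi> (\<lambda>z. f z + g z) = \<phi> f + \<phi> g) \<and>
      (\<forall>c. \<forall>f\<in>lab a b p. \<phi> (\<lambda>z. c * f z) = c * \<phi> f) \<and>
      (\<exists>C. \<forall>f\<in>lab a b p. norm (\<phi> f) \<le> C * lab_norm a b p f) \<and>
      (\<forall>f. f \<notin> lab a b p \<longrightarrow> \<phi> f = 0)}"

definition dual_norm :: "(nat \<Rightarrow> complex) \<Rightarrow> (nat \<Rightarrow> complex) \<Rightarrow> real \<Rightarrow> ((complex \<Rightarrow> complex) \<Rightarrow> complex) \<Rightarrow> real" where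
  "dual_norm a b p \<phi> = Sup {norm (\<phi> f) | f. f \<in> lab a b p \<and> lab_norm a b p f \<le> 1}"

definition dual_dist :: "(nat \<Rightarrow> complex) \<Rightarrow> (nat \<Rightarrow> complex) \<Rightarrow> real \<Rightarrow> ((complex \<Rightarrow> complex) \<Rightarrow> complex) \<Rightarrow> ((complex \<Rightarrow> complex) \<Rightarrow> complex) \<Rightarrow> real" where
  "dual_dist a b p \<phi> \<psi> = dual_norm a b p (\<lambda>f. \<phi> f - \<psi> f)"

definition fwd_adj :: "(nat \<Rightarrow> complex) \<Rightarrow> (nat \<Rightarrow> complex) \<Rightarrow> (nat \<Rightarrow> complex) \<Rightarrow> real \<Rightarrow> ((complex \<Rightarrow> complex) \<Rightarrow> complex) \<Rightarrow> (complex \<Rightarrow> complex) \<Rightarrow> complex" where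
  "fwd_adj a b w p \<phi> = (\<lambda>f. if f \<in> lab a b p then \<phi> (fwd_shift a b w f) else 0)"

definition periodic_pt :: "('x \<Rightarrow> 'x) \<Rightarrow> 'x \<Rightarrow> bool" where
  "periodic_pt T v \<longleftrightarrow> (\<exists>m\<ge>1. (T ^^ m) v = v)"

definition hypercyclic_on :: "'x set \<Rightarrow> ('x \<Rightarrow> 'x \<Rightarrow> real) \<Rightarrow> ('x \<Rightarrow> 'x) \<Rightarrow> bool" where
  "hypercyclic_on X d T \<longleftrightarrow>
     (\<exists>x\<in>X. \<forall>y\<in>X. \<forall>e>0. \<exists>n. d ((T ^^ n) x) y < e)"

definition chaotic_on :: "'x set \<Rightarrow> ('x \<Rightarrow> 'x \<Rightarrow> real) \<Rightarrow> ('x \<Rightarrow> 'x) \<Rightarrow> bool" where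
  "chaotic_on X d T \<longleftrightarrow> hypercyclic_on X d T \<and>
     (\<forall>y\<in>X. \<forall>e>0. \<exists>v\<in>X. periodic_pt T v \<and> d v y < e)"

end

theory Submission
  imports Defs
begin

text \<open>
  In the coordinates \<open>x n = taylor_coeff f n / a n\<close> the coefficients \<open>l\<close> of \<open>f\<close> with respect to
  \<open>fab a b\<close> satisfy \<open>x (n + 1) = l (n + 1) + c n * l n\<close> with \<open>c n = b n / a (n + 1)\<close>. As the upper
  limit of \<open>|c n|\<close> is less than 1, this bidiagonal map is an isomorphism of the sequence space
  of exponent \<open>p\<close>, so the norm of \<open>f\<close> is equivalent to the norm of \<open>x\<close>, the dual is the sequence
  space of exponent \<open>q\<close>, and the adjoint of the forward shift becomes a weighted backward
  shift there. Rescaling by \<open>rho n = a n / (w 0 * ... * w (n - 1))\<close> makes it the unweighted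
  backward shift on the sequences \<open>t\<close> with \<open>rho * t\<close> in the space of exponent \<open>q\<close>.

  If \<open>rho\<close> itself has exponent \<open>q\<close>, all bounded sequences are admissible: periodic sequences are
  dense, and concatenating all words over a countable dense set with long gaps gives a dense
  orbit. Conversely, a nonzero periodic sequence makes \<open>|rho|\<close> summable with exponent \<open>q\<close> along an
  arithmetic progression, and \<open>|rho n| \<le> M * |rho (n + 1)|\<close> transfers this to all indices.
\<close>

subsection \<open>Sequence spaces\<close>

text \<open>No root is taken, so that estimates stay additive; the norm is
  \<open>lp_sum p x powr (1 / p)\<close>.\<close>

definition lp_sum :: "real \<Rightarrow> (nat \<Rightarrow> complex) \<Rightarrow> real" where
  "lp_sum p x = (\<Sum>n. norm (x n) powr p)"

lemma powr_add_le:
  fixes s t p :: real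
  assumes "0 \<le> s" "0 \<le> t" "0 \<le> p"
  shows "(s + t) powr p \<le> 2 powr p * (s powr p + t powr p)"
proof -
  have "(s + t) powr p \<le> (2 * max s t) powr p"
    using assms by (intro powr_mono2) auto
  also have "\<dots> = 2 powr p * (max s t) powr p"
    using assms by (simp add: powr_mult)
  also have "\<dots> \<le> 2 powr p * (s powr p + t powr p)"
    by (intro mult_left_mono) (auto simp: max_def)
  finally show ?thesis .
qed

text \<open>Convexity of the p-th power, applied to \<open>(1 - r) * (s / (1 - r)) + r * t\<close>.
  Unlike in \<open>powr_add_le\<close>, the coefficient of \<open>t powr p\<close> is below 1, so
  this term can be absorbed in a recursion.\<close>

lemma powr_add_mult_le:
  fixes s t p r :: real
  assumes "0 \<le> s" "0 \<le> t" "1 \<le> p" "0 < r" "r < 1"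
  shows "(s + r * t) powr p \<le> (1 - r) powr (1 - p) * s powr p + r * t powr p"
proof -
  \<comment> \<open>Convexity is used only for positive arguments; if s or t vanishes, monotonicity
    in the exponent suffices.\<close>
  consider "s = 0" | "t = 0" | "s > 0" "t > 0" using assms by fastforce
  then show ?thesis
  proof cases
    case 1
    have "r powr p \<le> r powr 1" using assms by (intro powr_mono') auto
    then have "r powr p * t powr p \<le> r * t powr p"
      using assms by (intro mult_right_mono) auto
    with 1 assms show ?thesis by (simp add: powr_mult)
  next
    case 2
    have "(1 - r) powr 0 \<le> (1 - r) powr (1 - p)"
      using assms by (intro powr_mono') auto
    then have "1 * s powr p \<le> (1 - r) powr (1 - p) * s powr p"
      using assms by (intro mult_right_mono) auto
    with 2 assms show ?thesis by simp
  next
    case 3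
    have "((1 - r) *\<^sub>R (s / (1 - r)) + r *\<^sub>R t) powr p
        \<le> (1 - r) * (s / (1 - r)) powr p + r * t powr p"
      using 3 assms by (intro convex_onD[OF powr_convex]) auto
    also have "(1 - r) * (s / (1 - r)) powr p = (1 - r) powr (1 - p) * s powr p"
      using 3 assms by (simp add: powr_divide powr_diff)
    finally show ?thesis using assms by simp
  qed
qed

section \<open>Membership, bounds and tails of p-summable sequences\<close>

lemma in_lp_summable: "in_lp p x \<Longrightarrow> summable (\<lambda>n. norm (x n) powr p)"
  by (simp add: in_lp_def)

lemma lp_sum_nonneg: "in_lp p x \<Longrightarrow> 0 \<le> lp_sum p x"
  unfolding lp_sum_def in_lp_def by (rule suminf_nonneg) auto

lemma in_lp_of_partial_sums:
  assumes "\<And>N. (\<Sum>n<N. norm (x n) powr p) \<le> B"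
  shows "in_lp p x" "lp_sum p x \<le> B"
proof -
  show 1: "in_lp p x"
    unfolding in_lp_def by (rule summableI_nonneg_bounded[where x = B]) (use assms in auto)
  show "lp_sum p x \<le> B"
    unfolding lp_sum_def using assms 1 by (intro suminf_le_const) (auto simp: in_lp_def)
qed

lemma sum_powr_le_lp_sum:
  assumes "in_lp p x"
  shows "(\<Sum>n<N. norm (x n) powr p) \<le> lp_sum p x"
  unfolding lp_sum_def using assms by (intro sum_le_suminf) (auto simp: in_lp_def)

lemma in_lp_mono:
  assumes "in_lp p y" "\<And>n. norm (x n) \<le> C * norm (y n)" "0 \<le> C" "0 \<le> p"
  shows "in_lp p x" "lp_sum p x \<le> C powr p * lp_sum p y"
proof -
  have "(\<Sum>n<N. norm (x n) powr p) \<le> C powr p * lp_sum p y" for N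
  proof -
    have "(\<Sum>n<N. norm (x n) powr p) \<le> (\<Sum>n<N. (C * norm (y n)) powr p)"
      using assms by (intro sum_mono powr_mono2) auto
    also have "\<dots> = C powr p * (\<Sum>n<N. norm (y n) powr p)"
      using assms by (simp add: powr_mult sum_distrib_left)
    also have "\<dots> \<le> C powr p * lp_sum p y"
      using assms by (intro mult_left_mono sum_powr_le_lp_sum) auto
    finally show ?thesis .
  qed
  then show "in_lp p x" "lp_sum p x \<le> C powr p * lp_sum p y"
    by (rule in_lp_of_partial_sums)+
qed

lemma in_lp_cmult: "in_lp p x \<Longrightarrow> 0 \<le> p \<Longrightarrow> in_lp p (\<lambda>n. c * x n)"
  by (rule in_lp_mono(1)[where C = "norm c"]) (auto simp: norm_mult)

lemma in_lp_add:
  assumes "in_lp p x" "in_lp p y" "0 \<le> p"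
  shows "in_lp p (\<lambda>n. x n + y n)"
    and "lp_sum p (\<lambda>n. x n + y n) \<le> 2 powr p * (lp_sum p x + lp_sum p y)"
proof -
  have "(\<Sum>n<N. norm (x n + y n) powr p) \<le> 2 powr p * (lp_sum p x + lp_sum p y)" for N
  proof -
    have "(\<Sum>n<N. norm (x n + y n) powr p) \<le> (\<Sum>n<N. (norm (x n) + norm (y n)) powr p)"
      using assms by (intro sum_mono powr_mono2 norm_triangle_ineq) auto
    also have "\<dots> \<le> (\<Sum>n<N. 2 powr p * (norm (x n) powr p + norm (y n) powr p))"
      using assms by (intro sum_mono powr_add_le) auto
    also have "\<dots> = 2 powr p * ((\<Sum>n<N. norm (x n) powr p) + (\<Sum>n<N. norm (y n) powr p))"
      by (simp flip: sum_distrib_left sum.distrib)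
    also have "\<dots> \<le> 2 powr p * (lp_sum p x + lp_sum p y)"
      using assms by (intro mult_left_mono add_mono sum_powr_le_lp_sum) auto
    finally show ?thesis .
  qed
  then show "in_lp p (\<lambda>n. x n + y n)"
    "lp_sum p (\<lambda>n. x n + y n) \<le> 2 powr p * (lp_sum p x + lp_sum p y)"
    by (rule in_lp_of_partial_sums)+
qed

lemma in_lp_diff:
  assumes "in_lp p x" "in_lp p y" "0 \<le> p"
  shows "in_lp p (\<lambda>n. x n - y n)"
  using in_lp_add(1)[OF assms(1) in_lp_cmult[OF assms(2), of "-1"]] assms by simp

lemma in_lp_finite_support:
  assumes "\<And>n. n \<ge> N \<Longrightarrow> x n = 0"
  shows "in_lp p x" "lp_sum p x = (\<Sum>n<N. norm (x n) powr p)"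
proof -
  have "(\<lambda>n. norm (x n) powr p) sums (\<Sum>n<N. norm (x n) powr p)"
    using assms by (intro sums_finite) (auto simp: not_less)
  then show "in_lp p x" "lp_sum p x = (\<Sum>n<N. norm (x n) powr p)"
    by (auto simp: in_lp_def lp_sum_def sums_iff)
qed

lemma in_lp_bounded:
  assumes "in_lp p x" "0 < p"
  obtains M where "0 < M" "\<And>n. norm (x n) \<le> M"
proof -
  have "norm (x n) \<le> lp_sum p x powr (1 / p)" for n
  proof -
    have "norm (x n) powr p \<le> (\<Sum>i<Suc n. norm (x i) powr p)"
      by (auto intro: sum_nonneg)
    also have "\<dots> \<le> lp_sum p x" by (rule sum_powr_le_lp_sum[OF assms(1)])
    finally have "(norm (x n) powr p) powr (1 / p) \<le> lp_sum p x powr (1 / p)"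
      using assms by (intro powr_mono2) auto
    then show ?thesis using assms by (simp add: powr_powr)
  qed
  then show ?thesis
    using that[of "lp_sum p x powr (1 / p) + 1"] by (smt (verit) powr_ge_zero)
qed

lemma in_lp_Suc_iff: "in_lp p (\<lambda>n. x (Suc n)) \<longleftrightarrow> in_lp p x"
  unfolding in_lp_def by (rule summable_Suc_iff)

lemma lp_sum_Suc:
  assumes "in_lp p x"
  shows "lp_sum p x = norm (x 0) powr p + lp_sum p (\<lambda>n. x (Suc n))"
  unfolding lp_sum_def using suminf_split_head[OF in_lp_summable[OF assms]] by simp

lemma lp_tail:
  assumes "in_lp p x"
  shows "in_lp p (\<lambda>n. if n < N then 0 else x n)"
    and "lp_sum p (\<lambda>n. if n < N then 0 else x n) = (\<Sum>n. norm (x (n + N)) powr p)"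
proof -
  let ?t = "\<lambda>n. if n < N then 0 else x n"
  have 1: "summable (\<lambda>n. norm (?t (n + N)) powr p)"
    using summable_ignore_initial_segment[OF in_lp_summable[OF assms], of N] by simp
  then have 2: "summable (\<lambda>n. norm (?t n) powr p)"
    by (rule summable_iff_shift[THEN iffD1])
  then show "in_lp p ?t" by (simp add: in_lp_def)
  show "lp_sum p ?t = (\<Sum>n. norm (x (n + N)) powr p)"
    unfolding lp_sum_def using suminf_split_initial_segment[OF 2, of N] by simp
qed

lemma lp_tail_tendsto:
  assumes "in_lp p x"
  shows "(\<lambda>N. lp_sum p (\<lambda>n. if n < N then 0 else x n)) \<longlonglongrightarrow> 0"
proof -
  have "(\<lambda>N. \<Sum>n. norm (x (n + N)) powr p) \<longlonglongrightarrow> 0"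
    using suminf_exist_split2[OF in_lp_summable[OF assms]] .
  then show ?thesis using lp_tail(2)[OF assms] by simp
qed

text \<open>Young's inequality for the terms divided by their norms, then summation. A vanishing
  norm forbids the division but forces all products to be 0, which is a separate case.\<close>

lemma Holder_series:
  fixes x y :: "nat \<Rightarrow> complex"
  assumes p: "1 < p" "1 < q" "1 / p + 1 / q = 1" and x: "in_lp p x" and y: "in_lp q y"
  shows "summable (\<lambda>n. y n * x n)"
    and "norm (\<Sum>n. y n * x n) \<le> lp_sum q y powr (1 / q) * lp_sum p x powr (1 / p)"
proof -
  let ?P = "lp_sum p x" and ?Q = "lp_sum q y"
  note sx = in_lp_summable[OF x] and sy = in_lp_summable[OF y]
  have zero: "z n = 0" if "in_lp s z" "lp_sum s z = 0" for s z n
  proof -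
    have "(\<forall>n. norm (z n) powr s = 0)"
      using that suminf_eq_zero_iff[OF in_lp_summable[OF that(1)]] by (auto simp: lp_sum_def)
    then show ?thesis by auto
  qed
  have "summable (\<lambda>n. norm (y n * x n)) \<and>
    (\<Sum>n. norm (y n * x n)) \<le> ?Q powr (1 / q) * ?P powr (1 / p)"
  proof (cases "?P = 0 \<or> ?Q = 0")
    case True
    then have "y n * x n = 0" for n using zero[OF x] zero[OF y] by auto
    then have "norm (y n * x n) = 0" for n by simp
    then show ?thesis using lp_sum_nonneg[OF x] lp_sum_nonneg[OF y] by (simp only:) simp
  next
    case False
    then have pos: "?P > 0" "?Q > 0"
      using lp_sum_nonneg[OF x] lp_sum_nonneg[OF y] by auto
    let ?c = "?Q powr (1 / q) * ?P powr (1 / p)"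
    let ?h = "\<lambda>n. ?c * (norm (x n) powr p / ?P / p + norm (y n) powr q / ?Q / q)"
    have le: "norm (y n * x n) \<le> ?h n" for n
    proof -
      have "(norm (x n) / ?P powr (1 / p)) * (norm (y n) / ?Q powr (1 / q))
         \<le> (norm (x n) / ?P powr (1 / p)) powr p / p + (norm (y n) / ?Q powr (1 / q)) powr q / q"
        using p by (intro Youngs_inequality) auto
      also have "\<dots> = norm (x n) powr p / ?P / p + norm (y n) powr q / ?Q / q"
        using p pos by (simp add: powr_divide powr_powr)
      finally have "?c * ((norm (x n) / ?P powr (1 / p)) * (norm (y n) / ?Q powr (1 / q))) \<le> ?h n"
        by (intro mult_left_mono) auto
      then show ?thesis using pos by (simp add: norm_mult mult.commute)
    qed
    have "?h sums (?c * (?P / ?P / p + ?Q / ?Q / q))"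
      unfolding lp_sum_def by (intro sums_mult sums_add sums_divide summable_sums sx sy)
    then have h: "?h sums ?c" using pos p by simp
    have s: "summable (\<lambda>n. norm (y n * x n))"
      using le h by (intro summable_comparison_test'[OF sums_summable[OF h], of 0]) auto
    moreover have "(\<Sum>n. norm (y n * x n)) \<le> ?c"
      using suminf_le[OF le s sums_summable[OF h]] h by (simp add: sums_iff)
    ultimately show ?thesis by simp
  qed
  then show "summable (\<lambda>n. y n * x n)"
    and "norm (\<Sum>n. y n * x n) \<le> ?Q powr (1 / q) * ?P powr (1 / p)"
    using summable_norm_cancel summable_norm[of "\<lambda>n. y n * x n"] by (auto intro: order_trans)
qed

subsection \<open>Bidiagonal operators\<close>

text \<open>The lower bidiagonal matrix with ones on the diagonal and \<open>c\<close> just below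
  it.\<close>

definition bidiag :: "(nat \<Rightarrow> complex) \<Rightarrow> (nat \<Rightarrow> complex) \<Rightarrow> nat \<Rightarrow> complex" where
  "bidiag c l n = (case n of 0 \<Rightarrow> l 0 | Suc m \<Rightarrow> l (Suc m) + c m * l m)"

lemma bidiag_simps [simp]:
  "bidiag c l 0 = l 0" "bidiag c l (Suc n) = l (Suc n) + c n * l n"
  by (simp_all add: bidiag_def)

text \<open>Forward substitution, which inverts \<open>bidiag c\<close> on all sequences; only the
  norm estimates involve summability.\<close>

primrec bidiag_inv :: "(nat \<Rightarrow> complex) \<Rightarrow> (nat \<Rightarrow> complex) \<Rightarrow> nat \<Rightarrow> complex" where
  "bidiag_inv c x 0 = x 0"
| "bidiag_inv c x (Suc n) = x (Suc n) - c n * bidiag_inv c x n"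

lemma bidiag_bidiag_inv [simp]: "bidiag c (bidiag_inv c x) = x"
proof
  show "bidiag c (bidiag_inv c x) n = x n" for n by (cases n) simp_all
qed

lemma bidiag_inv_bidiag [simp]: "bidiag_inv c (bidiag c l) = l"
proof
  show "bidiag_inv c (bidiag c l) n = l n" for n by (induction n) simp_all
qed

section \<open>Upper and lower norm bounds for the bidiagonal operator\<close>

lemma bidiag_bound:
  assumes "\<And>n. norm (c n) \<le> M" "0 < p"
  obtains K where "0 < K"
    "\<And>l. in_lp p l \<Longrightarrow> in_lp p (bidiag c l) \<and> lp_sum p (bidiag c l) \<le> K * lp_sum p l"
proof
  have M: "0 \<le> M" using assms(1)[of 0] norm_ge_zero order_trans by blast
  show "0 < 2 powr p * (1 + M powr p)" by (intro mult_pos_pos add_pos_nonneg) auto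
  fix l assume l: "in_lp p l"
  define s where "s n = (case n of 0 \<Rightarrow> 0 | Suc m \<Rightarrow> c m * l m)" for n
  have ss: "in_lp p (\<lambda>n. s (Suc n))" "lp_sum p (\<lambda>n. s (Suc n)) \<le> M powr p * lp_sum p l"
    using assms M by (auto simp: s_def norm_mult intro!: in_lp_mono[OF l] mult_right_mono)
  then have s: "in_lp p s" by (simp add: in_lp_Suc_iff)
  have "lp_sum p s \<le> M powr p * lp_sum p l"
    using lp_sum_Suc[OF s] ss by (simp add: s_def)
  moreover have "bidiag c l = (\<lambda>n. l n + s n)"
    by (auto simp: fun_eq_iff s_def bidiag_def split: nat.split)
  ultimately show "in_lp p (bidiag c l) \<and>
      lp_sum p (bidiag c l) \<le> 2 powr p * (1 + M powr p) * lp_sum p l"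
    using in_lp_add[OF l s] assms
    by (simp add: algebra_simps) (smt (verit) mult_left_mono powr_ge_zero mult.assoc mult.commute)
qed

text \<open>
  The diagonal weights below turn finitely many large entries of \<open>c\<close> into entries below \<open>r\<close>,
  so that convexity of \<open>t \<mapsto> t powr p\<close> yields a contraction estimate for all indices at once.
\<close>
lemma bidiag_lower_bound_partial:
  assumes lim: "limsup (\<lambda>n. ereal (norm (c n))) < 1" and p: "1 \<le> p"
  obtains K where "0 < K"
    "\<And>l N. (\<Sum>n<N. norm (l n) powr p) \<le> K * (\<Sum>n<N. norm (bidiag c l n) powr p)"
proof -
  obtain r0 where r0: "limsup (\<lambda>n. ereal (norm (c n))) < ereal r0" "ereal r0 < 1"
    using ereal_dense2[OF lim] by blast
  \<comment> \<open>The maximum with 1/2 keeps \<open>r\<close> positive, as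
    \<open>powr_add_mult_le\<close> requires.\<close>
  define r where "r = max r0 (1 / 2)"
  have r: "0 < r" "r < 1" using r0 by (auto simp: r_def one_ereal_def)
  have "\<forall>\<^sub>F n in sequentially. ereal (norm (c n)) < ereal r0"
    by (rule Limsup_lessD[OF r0(1)])
  then have "\<forall>\<^sub>F n in sequentially. norm (c n) \<le> r"
    by eventually_elim (auto simp: r_def)
  then obtain N0 where N0: "\<And>n. n \<ge> N0 \<Longrightarrow> norm (c n) \<le> r"
    unfolding eventually_sequentially by auto
  define M where "M = (\<Sum>n<N0. norm (c n)) + 1"
  have M: "norm (c n) \<le> M" if "n < N0" for n
  proof -
    have "norm (c n) \<le> (\<Sum>n<N0. norm (c n))" using that by (intro member_le_sum) auto
    then show ?thesis by (simp add: M_def)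
  qed
  have M1: "1 \<le> M" by (auto simp: M_def intro: sum_nonneg)
  \<comment> \<open>Chosen so that \<open>e * M = r\<close>. Each of the first N0 steps lowers the
    weight \<open>d\<close> by the factor \<open>e\<close>, which brings entries of size up to M
    down to \<open>r\<close>; afterwards the entries are at most \<open>r\<close> and
    \<open>d\<close> is constant. As \<open>d\<close> stays between \<open>e ^ N0\<close> and 1, the
    weights cost only a constant.\<close>
  define e where "e = r / M"
  have e: "0 < e" "e \<le> 1" using r M1 by (auto simp: e_def field_simps)
  define d where "d n = e ^ min n N0" for n
  have d: "0 < d n" "d n \<le> 1" "e ^ N0 \<le> d n" for n
    using e by (auto simp: d_def intro!: power_le_one power_decreasing)
  have dc: "d (Suc n) * norm (c n) \<le> r * d n" for n
  proof (cases "n < N0")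
    case True
    have "e * norm (c n) \<le> e * M" using M[OF True] e by (intro mult_left_mono) auto
    also have "\<dots> = r" using M1 by (simp add: e_def)
    finally have "d n * (e * norm (c n)) \<le> d n * r" using d(1)[of n] by (intro mult_left_mono) auto
    then show ?thesis using True by (simp add: d_def min_def mult_ac)
  next
    case False
    then have "d (Suc n) = d n" by (simp add: d_def min_def)
    then show ?thesis using N0[of n] False d(1)[of n] by (simp add: mult.commute)
  qed
  define C where "C = (1 - r) powr (1 - p)"
  have C: "1 \<le> C"
    using powr_mono'[of "1 - p" 0 "1 - r"] r p by (simp add: C_def)
  \<comment> \<open>Division by \<open>1 - r\<close> comes from absorbing the recursion, division by
    \<open>(e ^ N0) powr p\<close> from removing the weights.\<close>
  define K where "K = C / ((1 - r) * (e ^ N0) powr p)"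
  have K: "0 < K" using C r e by (simp add: K_def)
  have main: "(\<Sum>n<N. norm (l n) powr p) \<le> K * (\<Sum>n<N. norm (bidiag c l n) powr p)" for l N
  proof (cases N)
    case 0
    then show ?thesis by simp
  next
    case (Suc N')
    let ?x = "bidiag c l"
    define L X where "L n = d n * norm (l n)" and "X n = d n * norm (?x n)" for n
    have nn: "0 \<le> L n" "0 \<le> X n" for n using d(1)[of n] by (auto simp: L_def X_def)
    have step: "L (Suc n) powr p \<le> C * X (Suc n) powr p + r * L n powr p" for n
    proof -
      have "norm (l (Suc n)) \<le> norm (?x (Suc n)) + norm (c n) * norm (l n)"
        using norm_triangle_ineq4[of "?x (Suc n)" "c n * l n"] by (simp add: norm_mult)
      then have "L (Suc n) \<le> d (Suc n) * (norm (?x (Suc n)) + norm (c n) * norm (l n))"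
        unfolding L_def using d(1)[of "Suc n"] by (intro mult_left_mono) auto
      also have "\<dots> = X (Suc n) + (d (Suc n) * norm (c n)) * norm (l n)"
        by (simp add: X_def algebra_simps)
      also have "\<dots> \<le> X (Suc n) + (r * d n) * norm (l n)"
        using dc by (intro add_left_mono mult_right_mono) auto
      finally have "L (Suc n) \<le> X (Suc n) + r * L n" by (simp add: L_def mult_ac)
      then have "L (Suc n) powr p \<le> (X (Suc n) + r * L n) powr p"
        using nn p by (intro powr_mono2) auto
      also have "\<dots> \<le> C * X (Suc n) powr p + r * L n powr p"
        unfolding C_def using nn p r by (intro powr_add_mult_le) auto
      finally show ?thesis .
    qed
    let ?SL = "\<Sum>n<N. L n powr p" and ?SX = "\<Sum>n<N. X n powr p"
    have "?SL = L 0 powr p + (\<Sum>n<N'. L (Suc n) powr p)"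
      unfolding Suc by (rule sum.lessThan_Suc_shift)
    also have "\<dots> \<le> C * X 0 powr p + (\<Sum>n<N'. C * X (Suc n) powr p + r * L n powr p)"
      using C by (intro add_mono sum_mono step)
        (auto simp: L_def X_def intro!: mult_right_mono[of 1 C, simplified])
    also have "\<dots> = C * (X 0 powr p + (\<Sum>n<N'. X (Suc n) powr p)) + r * (\<Sum>n<N'. L n powr p)"
      by (simp add: sum.distrib sum_distrib_left distrib_left)
    also have "X 0 powr p + (\<Sum>n<N'. X (Suc n) powr p) = ?SX"
      unfolding Suc by (rule sum.lessThan_Suc_shift[symmetric])
    \<comment> \<open>The sum up to N' is enlarged to \<open>?SL\<close> and then absorbed on the
      left, which is legitimate for arbitrary \<open>l\<close> because all sums are finite.\<close>
    also have "r * (\<Sum>n<N'. L n powr p) \<le> r * ?SL"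
      unfolding Suc using r by (intro mult_left_mono) auto
    finally have 1: "(1 - r) * ?SL \<le> C * ?SX" by (simp add: algebra_simps)
    have "(e ^ N0) powr p * (\<Sum>n<N. norm (l n) powr p) \<le> ?SL"
      unfolding sum_distrib_left L_def
      using d e p by (intro sum_mono) (auto simp: powr_mult intro!: mult_right_mono powr_mono2)
    then have "((1 - r) * (e ^ N0) powr p) * (\<Sum>n<N. norm (l n) powr p) \<le> (1 - r) * ?SL"
      using r by simp
    also note 1
    also have "?SX \<le> (\<Sum>n<N. norm (?x n) powr p)"
      unfolding X_def using d(2) less_imp_le[OF d(1)] p
      by (intro sum_mono powr_mono2) (auto simp: mult_left_le_one_le)
    then have "C * ?SX \<le> C * (\<Sum>n<N. norm (?x n) powr p)"
      using C by (intro mult_left_mono) auto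
    finally show ?thesis using r e by (simp add: K_def field_simps)
  qed
  show thesis using K main by (rule that)
qed

text \<open>The bound on partial sums holds for arbitrary \<open>l\<close>, so summability of the
  image forces that of \<open>l\<close>. Applied to \<open>bidiag_inv c x\<close>, this yields
  surjectivity of \<open>bidiag c\<close>.\<close>

lemma bidiag_lower_bound:
  assumes "limsup (\<lambda>n. ereal (norm (c n))) < 1" "1 \<le> p"
  obtains K where "0 < K"
    "\<And>l. in_lp p (bidiag c l) \<Longrightarrow> in_lp p l \<and> lp_sum p l \<le> K * lp_sum p (bidiag c l)"
proof -
  obtain K where K: "0 < K"
    "\<And>l N. (\<Sum>n<N. norm (l n) powr p) \<le> K * (\<Sum>n<N. norm (bidiag c l n) powr p)"
    using bidiag_lower_bound_partial[OF assms] by blast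
  have "in_lp p l \<and> lp_sum p l \<le> K * lp_sum p (bidiag c l)" if l: "in_lp p (bidiag c l)" for l
  proof -
    have "(\<Sum>n<N. norm (l n) powr p) \<le> K * lp_sum p (bidiag c l)" for N
    proof -
      have "K * (\<Sum>n<N. norm (bidiag c l n) powr p) \<le> K * lp_sum p (bidiag c l)"
        using K l by (intro mult_left_mono sum_powr_le_lp_sum) auto
      then show ?thesis using K(2)[of l N] by linarith
    qed
    then show ?thesis using in_lp_of_partial_sums by blast
  qed
  then show thesis using K that by blast
qed

lemma limsup_less_bounded:
  assumes "limsup (\<lambda>n. ereal (norm (c n :: complex))) < 1"
  obtains M where "\<And>n. norm (c n) \<le> M"
proof -
  have "\<forall>\<^sub>F n in sequentially. ereal (norm (c n)) < 1" by (rule Limsup_lessD[OF assms])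
  then have "Bseq c"
    by (intro BfunI[where K = 1]) (auto simp: one_ereal_def elim!: eventually_mono)
  then show thesis using that unfolding Bseq_def by blast
qed

subsection \<open>Sparse concatenation of words\<close>

text \<open>
  Placing the words at the positions \<open>pos k\<close> with sufficiently fast growing gaps, the sequence
  read from \<open>pos k\<close> on starts with the word \<open>W k\<close>, and all later words only meet tails of the
  summable weight.
\<close>
lemma sparse_concatenation:
  fixes v :: "nat \<Rightarrow> real" and W :: "nat \<Rightarrow> nat \<Rightarrow> complex" and len :: "nat \<Rightarrow> nat"
  assumes v: "summable v" "\<And>n. 0 \<le> v n"
    and len: "\<And>k i. len k \<le> i \<Longrightarrow> W k i = 0"
    and B: "\<And>k i. norm (W k i) \<le> B k"
    and q: "0 < q"
  shows "\<exists>t pos. pos 0 = (0 :: nat) \<and>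
    (\<forall>k I. (\<Sum>i<I. norm (t (i + pos k) - W k i) powr q * v i) \<le> (1 / 2) ^ k)"
proof -
  \<comment> \<open>The gap \<open>m j\<close> must make the positions increase, leave room for word
    j, and cut off so much of \<open>v\<close> that the remaining tail compensates the bound
    \<open>B (Suc j)\<close> of the next word.\<close>
  have "\<exists>m. 1 \<le> m \<and> len j \<le> m \<and>
      (\<forall>I. B (Suc j) powr q * (\<Sum>i\<in>{m..<I}. v i) \<le> (1 / 2) ^ Suc j)" for j
  proof -
    define e where "e = (1 / 2) ^ Suc j / (B (Suc j) powr q + 1)"
    have pos: "0 < B (Suc j) powr q + 1" by (simp add: add_nonneg_pos)
    then have e: "0 < e" by (simp add: e_def)
    obtain N where N: "\<And>m n. N \<le> m \<Longrightarrow> norm (sum v {m..<n}) < e"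
      using v(1) e unfolding summable_Cauchy by blast
    define m where "m = max N (max 1 (len j))"
    have "B (Suc j) powr q * (\<Sum>i\<in>{m..<I}. v i) \<le> (1 / 2) ^ Suc j" for I
    proof -
      have "sum v {m..<I} \<le> e" using N[of m I] by (auto simp: m_def)
      moreover have "0 \<le> sum v {m..<I}" by (intro sum_nonneg v)
      ultimately have "B (Suc j) powr q * sum v {m..<I} \<le> (B (Suc j) powr q + 1) * e"
        by (intro mult_mono) auto
      also have "\<dots> = (1 / 2) ^ Suc j" unfolding e_def times_divide_eq_right
        by (rule nonzero_mult_div_cancel_left) (use pos in simp)
      finally show ?thesis .
    qed
    then show ?thesis by (intro exI[of _ m]) (auto simp: m_def)
  qed
  then obtain m where m: "\<And>j. 1 \<le> m j" "\<And>j. len j \<le> m j"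
    "\<And>j I. B (Suc j) powr q * (\<Sum>i\<in>{m j..<I}. v i) \<le> (1 / 2) ^ Suc j"
    by metis
  define pos where "pos k = (\<Sum>j<k. m j)" for k
  have pos_Suc: "pos (Suc k) = pos k + m k" for k by (simp add: pos_def)
  have mono: "pos j \<le> pos k" if "j \<le> k" for j k
    unfolding pos_def using that by (intro sum_mono2) auto
  have ge: "k \<le> pos k" for k
  proof (induction k)
    case (Suc k)
    then show ?case using m(1)[of k] by (simp add: pos_Suc)
  qed simp
  \<comment> \<open>The word whose block contains n; the greatest index exists because
    \<open>k \<le> pos k\<close> bounds the candidates.\<close>
  define idx where "idx n = (GREATEST j. pos j \<le> n)" for n
  have bound: "j \<le> n" if "pos j \<le> n" for j n using ge[of j] that by linarith
  have idx_le: "pos (idx n) \<le> n" for n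
    unfolding idx_def by (rule GreatestI_nat[of _ 0 n]) (auto simp: pos_def intro: bound)
  have idx_ge: "j \<le> idx n" if "pos j \<le> n" for j n
    unfolding idx_def using that by (rule Greatest_le_nat) (rule bound)
  define t where "t n = W (idx n) (n - pos (idx n))" for n
  \<comment> \<open>If \<open>i + pos k\<close> lies in the block of a later word
    \<open>Suc j\<close>, then i is at least \<open>m j\<close> and \<open>m k\<close>, so
    \<open>W k i = 0\<close> and only \<open>B (Suc j)\<close> counts. Summing over all possible j
    gives a majorant that does not depend on which word is met.\<close>
  have est: "norm (t (i + pos k) - W k i) powr q * v i
      \<le> (\<Sum>j\<in>{k..<pos k + I}. if m j \<le> i then B (Suc j) powr q * v i else 0)"
    if "i < I" for i k I
  proof -
    let ?j = "idx (i + pos k)"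
    have nn: "0 \<le> (if m j \<le> i then B (Suc j) powr q * v i else 0)" for j
      using v(2)[of i] by simp
    have kj: "k \<le> ?j" by (rule idx_ge) simp
    show ?thesis
    proof (cases "?j = k")
      case True
      then show ?thesis using nn by (simp add: t_def sum_nonneg)
    next
      case False
      then obtain j where j: "?j = Suc j" "k \<le> j" using kj by (cases ?j) auto
      have "pos (Suc j) \<le> i + pos k" using idx_le[of "i + pos k"] j by simp
      moreover have "pos k \<le> pos j" using j(2) by (rule mono)
      moreover have "pos (Suc k) \<le> pos (Suc j)" using j(2) by (intro mono) simp
      ultimately have mj: "m j \<le> i" and mk: "m k \<le> i" by (auto simp: pos_Suc)
      have "W k i = 0" using m(2)[of k] mk by (intro len) linarith
      then have "norm (t (i + pos k) - W k i) \<le> B (Suc j)" by (simp add: t_def j(1) B)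
      then have "norm (t (i + pos k) - W k i) powr q * v i
          \<le> (if m j \<le> i then B (Suc j) powr q * v i else 0)"
        using mj v(2)[of i] q by (auto intro!: mult_right_mono powr_mono2)
      also have "\<dots> \<le> (\<Sum>j\<in>{k..<pos k + I}. if m j \<le> i then B (Suc j) powr q * v i else 0)"
      proof (rule member_le_sum)
        have "Suc j \<le> i + pos k" using idx_le[of "i + pos k"] ge[of "Suc j"] j by simp
        then show "j \<in> {k..<pos k + I}" using j(2) that by simp
      qed (use nn in auto)
      finally show ?thesis .
    qed
  qed
  have geo: "(\<Sum>j\<in>{k..<n}. (1 / 2) ^ Suc j) \<le> (1 / 2 :: real) ^ k" for k n :: nat
  proof -
    have "(\<Sum>j\<in>{k..<k + d}. (1 / 2) ^ Suc j) = (1 / 2 :: real) ^ k - (1 / 2) ^ (k + d)" for d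
      by (induction d) auto
    from this[of "n - k"] show ?thesis by (cases "k \<le> n") auto
  qed
  show ?thesis
  proof (intro exI[of _ t] exI[of _ pos] conjI allI)
    show "pos 0 = 0" by (simp add: pos_def)
    fix k I
    have "(\<Sum>i<I. norm (t (i + pos k) - W k i) powr q * v i)
        \<le> (\<Sum>i<I. \<Sum>j\<in>{k..<pos k + I}. if m j \<le> i then B (Suc j) powr q * v i else 0)"
      by (intro sum_mono est) auto
    \<comment> \<open>After the exchange each word contributes a tail of \<open>v\<close>, which the
      choice of \<open>m j\<close> bounds by \<open>(1 / 2) ^ Suc j\<close>.\<close>
    also have "\<dots> = (\<Sum>j\<in>{k..<pos k + I}. \<Sum>i<I. if m j \<le> i then B (Suc j) powr q * v i else 0)"
      by (rule sum.swap)
    also have "\<dots> = (\<Sum>j\<in>{k..<pos k + I}. B (Suc j) powr q * (\<Sum>i\<in>{m j..<I}. v i))"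
    proof (rule sum.cong[OF refl])
      fix j
      have "(\<Sum>i<I. if m j \<le> i then B (Suc j) powr q * v i else 0)
          = (\<Sum>i\<in>{m j..<I}. B (Suc j) powr q * v i)"
        by (rule sum.mono_neutral_cong_right) auto
      then show "(\<Sum>i<I. if m j \<le> i then B (Suc j) powr q * v i else 0)
          = B (Suc j) powr q * (\<Sum>i\<in>{m j..<I}. v i)" by (simp add: sum_distrib_left)
    qed
    also have "\<dots> \<le> (\<Sum>j\<in>{k..<pos k + I}. (1 / 2) ^ Suc j)" by (intro sum_mono m)
    also have "\<dots> \<le> (1 / 2) ^ k" by (rule geo)
    finally show "(\<Sum>i<I. norm (t (i + pos k) - W k i) powr q * v i) \<le> (1 / 2) ^ k" .
  qed
qed

text \<open>Every tuple over a countable dense set occurs as a word with arbitrarily large index.\<close>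
lemma dense_words:
  obtains W :: "nat \<Rightarrow> nat \<Rightarrow> complex" and len :: "nat \<Rightarrow> nat" and B :: "nat \<Rightarrow> real"
  where "\<And>k i. len k \<le> i \<Longrightarrow> W k i = 0" "\<And>k i. norm (W k i) \<le> B k"
    "\<And>s N e r. 0 < e \<Longrightarrow> \<exists>k\<ge>r. len k = N \<and> (\<forall>i<N. norm (W k i - s i) < e)"
proof -
  obtain D :: "complex set" where D: "countable D"
    "\<And>X. open X \<Longrightarrow> X \<noteq> {} \<Longrightarrow> \<exists>d\<in>D. d \<in> X"
    using countable_dense_exists by blast
  have ne: "D \<noteq> {}" using D(2)[of UNIV] by auto
  define g where "g = from_nat_into D"
  have g: "\<exists>j. norm (g j - z) < e" if e: "0 < e" for z e
  proof -
    obtain d where "d \<in> D" "d \<in> ball z e" using D(2)[of "ball z e"] e by auto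
    then show ?thesis
      using from_nat_into_surj[OF D(1), of d] by (auto simp: g_def dist_norm norm_minus_commute)
  qed
  \<comment> \<open>The first component of k codes a list; the second is a free counter that makes
    each list recur at arbitrarily large indices.\<close>
  define L where "L k = (from_nat (fst (prod_decode k)) :: nat list)" for k
  define W where "W k i = (if i < length (L k) then g (L k ! i) else 0)" for k i
  show thesis
  proof (rule that[of "\<lambda>k. length (L k)" W "\<lambda>k. \<Sum>i<length (L k). norm (W k i)"])
    show "length (L k) \<le> i \<Longrightarrow> W k i = 0" for k i by (simp add: W_def)
    show "norm (W k i) \<le> (\<Sum>i<length (L k). norm (W k i))" for k i
    proof (cases "i < length (L k)")
      case True
      then show ?thesis by (intro member_le_sum[of i _ "\<lambda>i. norm (W k i)"]) auto
    next
      case False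
      then have "W k i = 0" by (simp add: W_def)
      then show ?thesis by (simp add: sum_nonneg)
    qed
    fix s :: "nat \<Rightarrow> complex" and N r :: nat and e :: real
    assume e: "0 < e"
    have "\<forall>i. \<exists>j. norm (g j - s i) < e" using g[OF e] by blast
    then obtain j where j: "\<And>i. norm (g (j i) - s i) < e" by metis
    define k where "k = prod_encode (to_nat (map j [0..<N]), r)"
    have "L k = map j [0..<N]" by (simp add: L_def k_def)
    moreover have "r \<le> k" unfolding k_def by (rule le_prod_encode_2)
    ultimately show "\<exists>k\<ge>r. length (L k) = N \<and> (\<forall>i<N. norm (W k i - s i) < e)"
      using j by (intro exI[of _ k]) (simp add: W_def)
  qed
qed

subsection \<open>The space in Taylor coordinates\<close>

locale lab_space =
  fixes a b :: "nat \<Rightarrow> complex" and p :: real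
  assumes p: "1 < p" and a_nz: "\<And>n. a n \<noteq> 0"
    and growth: "limsup (\<lambda>n. ereal ((norm (a n) + norm (b n)) powr (1 / real n))) < \<infinity>"
    and ba_lim: "limsup (\<lambda>n. ereal (norm (b n / a (Suc n)))) < 1"
begin

abbreviation disc :: "complex \<Rightarrow> bool" where
  "disc z \<equiv> ereal (norm z) < radius_ab a b"

definition c :: "nat \<Rightarrow> complex" where "c n = b n / a (Suc n)"

text \<open>The inverse of passing from f to the coordinates \<open>taylor_coeff f n / a n\<close>;
  the value 0 off the disc follows the convention of \<open>lab\<close>.\<close>

definition E :: "(nat \<Rightarrow> complex) \<Rightarrow> complex \<Rightarrow> complex" where
  "E x z = (if disc z then \<Sum>n. a n * x n * z ^ n else 0)"

section \<open>Convergence on the disc and Taylor coefficients\<close>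

lemma radius_pos: "0 < radius_ab a b"
proof -
  have "0 \<le> limsup (\<lambda>n. ereal ((norm (a n) + norm (b n)) powr (1 / real n)))"
    by (intro le_Limsup) auto
  then show ?thesis using growth by (auto simp: radius_ab_def ereal_0_gt_inverse)
qed

lemma radius_eq_conv_radius: "radius_ab a b = conv_radius (\<lambda>n. norm (a n) + norm (b n))"
proof -
  \<comment> \<open>At n = 0 the two sides differ, \<open>powr\<close> giving 1 and
    \<open>root\<close> giving 0; the upper limit does not see this index.\<close>
  have "(norm (a n) + norm (b n)) powr (1 / real n) = root n (norm (a n) + norm (b n))"
    if "n > 0" for n
    using that a_nz[of n] by (simp add: root_powr_inverse add_pos_nonneg inverse_eq_divide)
  then have "\<forall>\<^sub>F n in sequentially. ereal ((norm (a n) + norm (b n)) powr (1 / real n)) =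
      ereal (root n (norm (norm (a n) + norm (b n))))"
    by (intro eventually_mono[OF eventually_gt_at_top[of 0]]) (simp add: abs_of_nonneg)
  then show ?thesis
    unfolding radius_ab_def conv_radius_def by (subst Limsup_eq) auto
qed

lemma summable_weights:
  assumes "disc z"
  shows "summable (\<lambda>n. (norm (a n) + norm (b n)) * norm z ^ n)"
  using summable_in_conv_radius[of "norm z" "\<lambda>n. norm (a n) + norm (b n)"] assms
  by (simp add: radius_eq_conv_radius)

lemma
  assumes "disc z" "in_lp p x"
  shows summable_a: "summable (\<lambda>n. a n * x n * z ^ n)"
    and summable_b: "summable (\<lambda>n. b n * x n * z ^ n)"
proof -
  obtain M where M: "0 < M" "\<And>n. norm (x n) \<le> M"
    using in_lp_bounded[OF assms(2)] p by auto
  have s: "summable (\<lambda>n. M * ((norm (a n) + norm (b n)) * norm z ^ n))"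
    by (intro summable_mult summable_weights assms)
  have "norm (d * x n * z ^ n) \<le> M * ((norm (a n) + norm (b n)) * norm z ^ n)"
    if "norm d \<le> norm (a n) + norm (b n)" for d n
  proof -
    have "norm d * norm (x n) * norm z ^ n \<le> (norm (a n) + norm (b n)) * M * norm z ^ n"
      using that M by (intro mult_right_mono mult_mono) auto
    then show ?thesis by (simp add: norm_mult norm_power mult_ac)
  qed
  then show "summable (\<lambda>n. a n * x n * z ^ n)" "summable (\<lambda>n. b n * x n * z ^ n)"
    by (auto intro!: summable_comparison_test'[OF s, of 0])
qed

lemma taylor_coeff_eqI:
  assumes "\<And>z. disc z \<Longrightarrow> (\<lambda>n. m n * z ^ n) sums f z"
  shows "taylor_coeff f n = m n"
proof -
  have "\<forall>\<^sub>F z in nhds 0. z \<in> eball 0 (radius_ab a b)"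
    using radius_pos by (intro eventually_nhds_in_open) (auto simp: zero_ereal_def)
  then have "\<forall>\<^sub>F z in nhds 0. (\<lambda>n. fps_nth (Abs_fps m) n * z ^ n) sums f z"
    by eventually_elim (use assms in auto)
  then have "f has_fps_expansion Abs_fps m" by (rule has_fps_expansionI)
  from fps_nth_fps_expansion[OF this, of n] show ?thesis by (simp add: taylor_coeff_def)
qed

lemma E_sums: "disc z \<Longrightarrow> in_lp p x \<Longrightarrow> (\<lambda>n. a n * x n * z ^ n) sums E x z"
  by (simp add: E_def summable_sums summable_a)

lemma taylor_coeff_E: "in_lp p x \<Longrightarrow> taylor_coeff (E x) n = a n * x n"
  by (rule taylor_coeff_eqI) (rule E_sums)

section \<open>The space as a renormed sequence space\<close>

lemma c_bidiag_bound:
  obtains K where "0 < K"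
    "\<And>l. in_lp p l \<Longrightarrow> in_lp p (bidiag c l) \<and> lp_sum p (bidiag c l) \<le> K * lp_sum p l"
proof -
  obtain M where "\<And>n. norm (c n) \<le> M"
    using limsup_less_bounded[OF ba_lim] unfolding c_def by blast
  then show thesis using bidiag_bound[of c M p] p that by auto
qed

lemma c_bidiag_lower_bound:
  obtains K where "0 < K"
    "\<And>l. in_lp p (bidiag c l) \<Longrightarrow> in_lp p l \<and> lp_sum p l \<le> K * lp_sum p (bidiag c l)"
proof -
  have "limsup (\<lambda>n. ereal (norm (c n))) < 1" "1 \<le> p"
    using ba_lim p by (simp_all add: c_def)
  then show thesis using bidiag_lower_bound that by blast
qed

lemma in_lp_bidiag: "in_lp p l \<Longrightarrow> in_lp p (bidiag c l)"
  by (rule c_bidiag_bound) blast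

lemma in_lp_bidiag_inv:
  assumes "in_lp p x"
  shows "in_lp p (bidiag_inv c x)"
proof (rule c_bidiag_lower_bound)
  fix K
  assume "\<And>l. in_lp p (bidiag c l) \<Longrightarrow> in_lp p l \<and> lp_sum p l \<le> K * lp_sum p (bidiag c l)"
  from this[of "bidiag_inv c x"] assms show ?thesis by simp
qed

text \<open>The part of the n-th term with \<open>b n\<close> is regrouped with the next term:
  \<open>z ^ Suc n\<close> receives the coefficient
  \<open>a (Suc n) * (l (Suc n) + c n * l n)\<close>.\<close>

lemma fab_sums_E_bidiag:
  assumes z: "disc z" and l: "in_lp p l"
  shows "(\<lambda>n. l n * fab a b n z) sums E (bidiag c l) z"
proof -
  let ?u = "\<lambda>n. a n * l n * z ^ n" and ?v = "\<lambda>n. b n * l n * z ^ n"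
  note su = summable_a[OF z l] and sv = summable_b[OF z l]
  have shift: "a (Suc n) * bidiag c l (Suc n) * z ^ Suc n = ?u (Suc n) + z * ?v n" for n
    using a_nz[of "Suc n"] by (simp add: c_def field_simps)
  have "(\<lambda>n. a (Suc n) * bidiag c l (Suc n) * z ^ Suc n) sums (suminf ?u - ?u 0 + z * suminf ?v)"
    unfolding shift by (intro sums_add sums_mult summable_sums sv)
      (use summable_sums[OF su] sums_Suc_iff[of ?u "suminf ?u - ?u 0"] in simp)
  then have "(\<lambda>n. a n * bidiag c l n * z ^ n) sums (suminf ?u + z * suminf ?v)"
    using sums_Suc_iff[of "\<lambda>n. a n * bidiag c l n * z ^ n"
        "suminf ?u - ?u 0 + z * suminf ?v"] by simp
  moreover have "(\<lambda>n. a n * bidiag c l n * z ^ n) sums E (bidiag c l) z"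
    using z l by (intro E_sums in_lp_bidiag)
  moreover have "(\<lambda>n. l n * fab a b n z) sums (suminf ?u + z * suminf ?v)"
  proof -
    have "(\<lambda>n. ?u n + z * ?v n) sums (suminf ?u + z * suminf ?v)"
      by (intro sums_add sums_mult summable_sums su sv)
    then show ?thesis by (simp add: fab_def algebra_simps)
  qed
  ultimately show ?thesis by (simp add: sums_iff)
qed

lemma E_in_lab: "in_lp p x \<Longrightarrow> E x \<in> lab a b p"
  using fab_sums_E_bidiag[of _ "bidiag_inv c x"] in_lp_bidiag_inv[of x]
  unfolding lab_def by (auto simp: sums_iff E_def intro!: exI[of _ "bidiag_inv c x"])

lemma lab_obtain:
  assumes "f \<in> lab a b p"
  obtains x where "in_lp p x" "f = E x"
proof -
  obtain l where l: "in_lp p l"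
    "\<And>z. f z = (if disc z then (\<Sum>n. l n * fab a b n z) else 0)"
    using assms unfolding lab_def by auto
  have "f z = E (bidiag c l) z" for z
    using l fab_sums_E_bidiag[of z l] by (auto simp: sums_iff) (simp add: E_def)
  then show thesis using that[OF in_lp_bidiag[OF l(1)]] by auto
qed

text \<open>Uniqueness behind the definite description: any coefficient sequence \<open>l\<close> of
  the same function gives the Taylor coefficients \<open>a n * bidiag c l n\<close>, so
  \<open>bidiag c l = x\<close>, and \<open>bidiag c\<close> is injective.\<close>

lemma lab_coeffs_E:
  assumes "in_lp p x"
  shows "lab_coeffs a b p (E x) = bidiag_inv c x"
  unfolding lab_coeffs_def
proof (rule the_equality)
  show "in_lp p (bidiag_inv c x) \<and>
      (\<forall>z. disc z \<longrightarrow> E x z = (\<Sum>n. bidiag_inv c x n * fab a b n z))"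
    using fab_sums_E_bidiag[of _ "bidiag_inv c x"] in_lp_bidiag_inv[OF assms]
    by (auto simp: sums_iff)
next
  fix l assume l: "in_lp p l \<and> (\<forall>z. disc z \<longrightarrow> E x z = (\<Sum>n. l n * fab a b n z))"
  have "taylor_coeff (E x) n = a n * bidiag c l n" for n
  proof (rule taylor_coeff_eqI)
    fix z assume z: "disc z"
    have "E x z = E (bidiag c l) z"
      using l z fab_sums_E_bidiag[of z l] by (auto simp: sums_iff)
    then show "(\<lambda>n. a n * bidiag c l n * z ^ n) sums E x z"
      using E_sums[OF z in_lp_bidiag[of l]] l by simp
  qed
  then have "bidiag c l = x" using taylor_coeff_E[OF assms] a_nz by auto
  then show "l = bidiag_inv c x" by (metis bidiag_inv_bidiag)
qed

lemma lab_norm_E: "in_lp p x \<Longrightarrow> lab_norm a b p (E x) = lp_sum p (bidiag_inv c x) powr (1 / p)"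
  by (simp add: lab_norm_def lab_coeffs_E lp_sum_def)

text \<open>The norm of \<open>E x\<close> is that of \<open>bidiag_inv c x\<close>, so the lower
  bound for \<open>bidiag c\<close> gives the first inequality and its boundedness the
  second.\<close>

lemma lab_norm_equiv:
  "\<exists>K>0. \<forall>x. in_lp p x \<longrightarrow> lab_norm a b p (E x) \<le> K * lp_sum p x powr (1 / p) \<and>
    lp_sum p x powr (1 / p) \<le> K * lab_norm a b p (E x)"
proof -
  obtain K1 where K1: "0 < K1"
    "\<And>l. in_lp p l \<Longrightarrow> in_lp p (bidiag c l) \<and> lp_sum p (bidiag c l) \<le> K1 * lp_sum p l"
    using c_bidiag_bound by blast
  obtain K2 where K2: "0 < K2"
    "\<And>l. in_lp p (bidiag c l) \<Longrightarrow> in_lp p l \<and> lp_sum p l \<le> K2 * lp_sum p (bidiag c l)"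
    using c_bidiag_lower_bound by blast
  define K where "K = max K1 K2 powr (1 / p)"
  have root: "s powr (1 / p) \<le> K * t powr (1 / p)"
    if "s \<le> K' * t" "0 \<le> s" "0 \<le> t" "0 \<le> K'" "K' \<le> max K1 K2" for s t K'
  proof -
    have "s \<le> max K1 K2 * t" using that by (meson mult_right_mono order_trans)
    then have "s powr (1 / p) \<le> (max K1 K2 * t) powr (1 / p)"
      using that p by (intro powr_mono2) auto
    then show ?thesis using that K1 K2 by (simp add: K_def powr_mult)
  qed
  show ?thesis
  proof (intro exI[of _ K] conjI allI impI)
    show "0 < K" using K1 by (simp add: K_def)
    fix x assume x: "in_lp p x"
    note l = in_lp_bidiag_inv[OF x]
    show "lab_norm a b p (E x) \<le> K * lp_sum p x powr (1 / p)"
      unfolding lab_norm_E[OF x]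
      using K2(2)[of "bidiag_inv c x"] x l K2(1) by (intro root[of _ K2]) (auto simp: lp_sum_nonneg)
    show "lp_sum p x powr (1 / p) \<le> K * lab_norm a b p (E x)"
      unfolding lab_norm_E[OF x]
      using K1(2)[of "bidiag_inv c x"] x l K1(1) by (intro root[of _ K1]) (auto simp: lp_sum_nonneg)
  qed
qed

section \<open>Linearity of \<open>E\<close> and the forward shift in coordinates\<close>

lemma E_add:
  assumes "in_lp p x" "in_lp p y"
  shows "E (\<lambda>n. x n + y n) = (\<lambda>z. E x z + E y z)"
proof
  fix z
  show "E (\<lambda>n. x n + y n) z = E x z + E y z"
  proof (cases "disc z")
    case True
    from suminf_add[OF summable_a[OF True assms(1)] summable_a[OF True assms(2)]] True
    show ?thesis by (simp add: E_def distrib_left distrib_right)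
  qed (simp add: E_def)
qed

lemma E_cmult:
  assumes "in_lp p x"
  shows "E (\<lambda>n. k * x n) = (\<lambda>z. k * E x z)"
proof
  fix z
  show "E (\<lambda>n. k * x n) z = k * E x z"
  proof (cases "disc z")
    case True
    have "a n * (k * x n) * z ^ n = k * (a n * x n * z ^ n)" for n by (simp add: mult_ac)
    with suminf_mult[OF summable_a[OF True assms], of k] True
    show ?thesis by (simp only: E_def if_True)
  qed (simp add: E_def)
qed

lemma E_zero: "E (\<lambda>n. 0) = (\<lambda>z. 0)"
  by (simp add: E_def fun_eq_iff)

definition wshift :: "(nat \<Rightarrow> complex) \<Rightarrow> (nat \<Rightarrow> complex) \<Rightarrow> nat \<Rightarrow> complex" where
  "wshift u x n = (case n of 0 \<Rightarrow> 0 | Suc m \<Rightarrow> u m * x m)"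

lemma in_lp_wshift:
  assumes "in_lp p x" "\<And>n. norm (u n) \<le> M"
  shows "in_lp p (wshift u x)"
proof -
  have "0 \<le> M" using assms(2)[of 0] norm_ge_zero order_trans by blast
  then have "in_lp p (\<lambda>n. wshift u x (Suc n))"
    using assms p by (intro in_lp_mono(1)[OF assms(1), of _ M])
      (auto simp: wshift_def norm_mult intro!: mult_right_mono)
  then show ?thesis by (simp add: in_lp_Suc_iff)
qed

text \<open>The coefficient \<open>a n * x n * w n\<close> moves to place n + 1, where returning to
  coordinates divides by \<open>a (Suc n)\<close>; hence the weight.\<close>

lemma fwd_shift_E:
  assumes "in_lp p x" "\<And>n. norm (w n * a n / a (Suc n)) \<le> M"
  shows "fwd_shift a b w (E x) = E (wshift (\<lambda>n. w n * a n / a (Suc n)) x)" (is "_ = E ?y")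
proof
  fix z
  have y: "in_lp p ?y" using assms by (rule in_lp_wshift)
  have "(\<Sum>n. a n * x n * w n * z ^ Suc n) = (\<Sum>n. a n * ?y n * z ^ n)" if z: "disc z"
  proof -
    have "(\<Sum>n. a (Suc n) * ?y (Suc n) * z ^ Suc n) = (\<Sum>n. a n * ?y n * z ^ n)"
      using suminf_split_head[OF summable_a[OF z y]]
      by (simp add: wshift_def del: power_Suc)
    moreover have "a (Suc n) * ?y (Suc n) * z ^ Suc n = a n * x n * w n * z ^ Suc n" for n
      using a_nz[of "Suc n"] by (simp add: wshift_def)
    ultimately show ?thesis by (simp only:)
  qed
  then show "fwd_shift a b w (E x) z = E ?y z"
    using taylor_coeff_E[OF assms(1)] by (simp add: fwd_shift_def E_def)
qed

end

subsection \<open>The dual space\<close>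

locale lab_dual_space = lab_space +
  fixes q :: real
  assumes pq: "1 / p + 1 / q = 1"
begin

lemma q: "1 < q"
proof -
  have "1 / q = 1 - 1 / p" using pq by simp
  moreover have "0 < 1 - 1 / p" "1 - 1 / p < 1" using p by auto
  ultimately show ?thesis by (metis divide_less_eq_1_pos zero_less_divide_1_iff)
qed

text \<open>The bilinear pairing of \<open>y\<close> with the coordinates of f, without conjugation;
  the value 0 off the space is the normalisation in \<open>lab_dual\<close>.\<close>

definition Phi :: "(nat \<Rightarrow> complex) \<Rightarrow> (complex \<Rightarrow> complex) \<Rightarrow> complex" where
  "Phi y f = (if f \<in> lab a b p then \<Sum>n. y n * (taylor_coeff f n / a n) else 0)"

definition unit_seq :: "nat \<Rightarrow> nat \<Rightarrow> complex" where
  "unit_seq n i = (if i = n then 1 else 0)"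

lemma in_lp_unit_seq: "in_lp s (unit_seq n)"
  by (rule in_lp_finite_support(1)[of "Suc n"]) (simp add: unit_seq_def)

lemma Phi_E: "in_lp p x \<Longrightarrow> Phi y (E x) = (\<Sum>n. y n * x n)"
  using a_nz by (simp add: Phi_def E_in_lab taylor_coeff_E)

lemma Phi_unit_seq: "Phi y (E (unit_seq n)) = y n"
proof -
  have "(\<Sum>i. y i * unit_seq n i) = (\<Sum>i. if i = n then y i else 0)"
    by (intro suminf_cong) (simp add: unit_seq_def)
  also have "\<dots> = y n" using sums_single[of n y] by (simp add: sums_iff)
  finally show ?thesis by (simp add: Phi_E in_lp_unit_seq)
qed

lemma Phi_inject: "Phi y = Phi y' \<Longrightarrow> y = y'"
  by (metis Phi_unit_seq ext)

lemma Phi_zero: "Phi (\<lambda>n. 0) = (\<lambda>f. 0)"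
  by (simp add: Phi_def fun_eq_iff)

lemmas Holder = Holder_series[OF p q pq]

lemma Phi_diff:
  assumes "in_lp q y" "in_lp q y'"
  shows "(\<lambda>f. Phi y f - Phi y' f) = Phi (\<lambda>n. y n - y' n)"
proof
  fix f
  show "Phi y f - Phi y' f = Phi (\<lambda>n. y n - y' n) f"
  proof (cases "f \<in> lab a b p")
    case True
    then obtain x where x: "in_lp p x" "f = E x" by (rule lab_obtain)
    show ?thesis
      using suminf_diff[OF Holder(1)[OF x(1) assms(1)] Holder(1)[OF x(1) assms(2)]]
      by (simp add: x Phi_E left_diff_distrib)
  qed (simp add: Phi_def)
qed

lemma Phi_bound:
  obtains K where "0 < K"
    "\<And>x y. in_lp p x \<Longrightarrow> in_lp q y \<Longrightarrow>
      norm (Phi y (E x)) \<le> K * lp_sum q y powr (1 / q) * lab_norm a b p (E x)"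
proof -
  obtain K where K: "0 < K"
    "\<And>x. in_lp p x \<Longrightarrow> lab_norm a b p (E x) \<le> K * lp_sum p x powr (1 / p)"
    "\<And>x. in_lp p x \<Longrightarrow> lp_sum p x powr (1 / p) \<le> K * lab_norm a b p (E x)"
    using lab_norm_equiv by blast
  show thesis
  proof (rule that[OF K(1)])
    fix x y assume x: "in_lp p x" and y: "in_lp q y"
    have "norm (Phi y (E x)) \<le> lp_sum q y powr (1 / q) * lp_sum p x powr (1 / p)"
      using Holder(2)[OF x y] by (simp add: Phi_E[OF x])
    also have "\<dots> \<le> lp_sum q y powr (1 / q) * (K * lab_norm a b p (E x))"
      by (intro mult_left_mono K(2,3) x) auto
    finally show "norm (Phi y (E x)) \<le> K * lp_sum q y powr (1 / q) * lab_norm a b p (E x)"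
      by (simp add: mult_ac)
  qed
qed

lemma Phi_in_dual:
  assumes y: "in_lp q y"
  shows "Phi y \<in> lab_dual a b p"
proof -
  have add: "Phi y (\<lambda>z. f z + g z) = Phi y f + Phi y g"
    if fg: "f \<in> lab a b p" "g \<in> lab a b p" for f g
  proof -
    obtain x where x: "in_lp p x" "f = E x" using fg(1) by (rule lab_obtain)
    obtain x' where x': "in_lp p x'" "g = E x'" using fg(2) by (rule lab_obtain)
    have "(\<Sum>n. y n * (x n + x' n)) = (\<Sum>n. y n * x n) + (\<Sum>n. y n * x' n)"
      using suminf_add[OF Holder(1)[OF x(1) y] Holder(1)[OF x'(1) y]] by (simp add: distrib_left)
    moreover have "in_lp p (\<lambda>n. x n + x' n)" using x x' p by (intro in_lp_add) auto
    ultimately show ?thesis using x x' by (simp add: Phi_E flip: E_add)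
  qed
  have cmult: "Phi y (\<lambda>z. k * f z) = k * Phi y f" if f: "f \<in> lab a b p" for k f
  proof -
    obtain x where x: "in_lp p x" "f = E x" using f by (rule lab_obtain)
    have "(\<Sum>n. y n * (k * x n)) = k * (\<Sum>n. y n * x n)"
      using suminf_mult[OF Holder(1)[OF x(1) y], of k] by (simp add: mult.left_commute)
    moreover have "in_lp p (\<lambda>n. k * x n)" using x p by (intro in_lp_cmult) auto
    ultimately show ?thesis using x by (simp add: Phi_E flip: E_cmult)
  qed
  obtain K where "0 < K" and K:
    "\<And>x y. in_lp p x \<Longrightarrow> in_lp q y \<Longrightarrow>
      norm (Phi y (E x)) \<le> K * lp_sum q y powr (1 / q) * lab_norm a b p (E x)"
    using Phi_bound by blast
  have "norm (Phi y f) \<le> K * lp_sum q y powr (1 / q) * lab_norm a b p f"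
    if f: "f \<in> lab a b p" for f
  proof -
    obtain x where "in_lp p x" "f = E x" using f by (rule lab_obtain)
    then show ?thesis using K[OF _ y] by simp
  qed
  then have "\<exists>C. \<forall>f\<in>lab a b p. norm (Phi y f) \<le> C * lab_norm a b p f" by blast
  with add cmult show ?thesis unfolding lab_dual_def by (simp add: Phi_def)
qed

lemma dual_norm_Phi_le:
  obtains K where "0 < K"
    "\<And>y. in_lp q y \<Longrightarrow> dual_norm a b p (Phi y) \<le> K * lp_sum q y powr (1 / q)"
proof -
  obtain K where K: "0 < K"
    "\<And>x y. in_lp p x \<Longrightarrow> in_lp q y \<Longrightarrow>
      norm (Phi y (E x)) \<le> K * lp_sum q y powr (1 / q) * lab_norm a b p (E x)"
    using Phi_bound by blast
  show thesis
  proof (rule that[OF K(1)])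
    fix y assume y: "in_lp q y"
    \<comment> \<open>The zero function shows that the supremum is taken over a nonempty
      set.\<close>
    have z: "in_lp p (\<lambda>n. 0)" "lp_sum p (\<lambda>n. 0) = 0"
      using in_lp_finite_support[of 0 "\<lambda>n. 0" p] by auto
    obtain K' where "lab_norm a b p (E (\<lambda>n. 0)) \<le> K' * lp_sum p (\<lambda>n. 0) powr (1 / p)"
      using lab_norm_equiv z by blast
    then have "lab_norm a b p (E (\<lambda>n. 0)) \<le> 1" by (simp add: z)
    then have ne: "{norm (Phi y f) |f. f \<in> lab a b p \<and> lab_norm a b p f \<le> 1} \<noteq> {}"
      using E_in_lab[OF z(1)] by blast
    show "dual_norm a b p (Phi y) \<le> K * lp_sum q y powr (1 / q)"
      unfolding dual_norm_def
    proof (rule cSup_least[OF ne])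
      fix t assume "t \<in> {norm (Phi y f) |f. f \<in> lab a b p \<and> lab_norm a b p f \<le> 1}"
      then obtain f where f: "t = norm (Phi y f)" "f \<in> lab a b p" "lab_norm a b p f \<le> 1" by auto
      obtain x where x: "in_lp p x" "f = E x" using f(2) by (rule lab_obtain)
      have "t \<le> K * lp_sum q y powr (1 / q) * lab_norm a b p f"
        using K(2)[OF x(1) y] x f by simp
      also have "\<dots> \<le> K * lp_sum q y powr (1 / q) * 1"
        using K f by (intro mult_left_mono) auto
      finally show "t \<le> K * lp_sum q y powr (1 / q)" by simp
    qed
  qed
qed

text \<open>Tested on \<open>E (unit_seq n)\<close>, scaled by 1 / L into the unit ball. The bound
  later keeps a nonzero functional at positive distance from 0.\<close>

lemma dual_norm_Phi_ge:
  obtains e where "0 < e" "\<And>y n. in_lp q y \<Longrightarrow> e * norm (y n) \<le> dual_norm a b p (Phi y)"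
proof -
  obtain K where K: "0 < K"
    "\<And>x y. in_lp p x \<Longrightarrow> in_lp q y \<Longrightarrow>
      norm (Phi y (E x)) \<le> K * lp_sum q y powr (1 / q) * lab_norm a b p (E x)"
    using Phi_bound by blast
  obtain L where L: "0 < L"
    "\<And>x. in_lp p x \<Longrightarrow> lab_norm a b p (E x) \<le> L * lp_sum p x powr (1 / p)"
    "\<And>x. in_lp p x \<Longrightarrow> lp_sum p x powr (1 / p) \<le> L * lab_norm a b p (E x)"
    using lab_norm_equiv by blast
  have "1 / L * norm (y n) \<le> dual_norm a b p (Phi y)" if y: "in_lp q y" for y n
  proof -
    define x where "x i = complex_of_real (1 / L) * unit_seq n i" for i
    have x: "in_lp p x" unfolding x_def using p by (intro in_lp_cmult in_lp_unit_seq) auto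
    have "lp_sum p x = (\<Sum>i<Suc n. norm (x i) powr p)"
      by (rule in_lp_finite_support(2)) (simp add: x_def unit_seq_def)
    also have "\<dots> = (1 / L) powr p" using L by (simp add: x_def unit_seq_def norm_divide)
    finally have "lp_sum p x powr (1 / p) = 1 / L" using p L by (simp add: powr_powr)
    then have le1: "lab_norm a b p (E x) \<le> 1" using L(2)[OF x] L(1) by simp
    have "Phi y (E x) = 1 / L * y n"
    proof -
      have "Phi y (\<lambda>z. complex_of_real (1 / L) * E (unit_seq n) z) =
          complex_of_real (1 / L) * Phi y (E (unit_seq n))"
        using Phi_in_dual[OF y] E_in_lab[OF in_lp_unit_seq] unfolding lab_dual_def by blast
      then show ?thesis
        unfolding x_def E_cmult[OF in_lp_unit_seq] by (simp add: Phi_unit_seq)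
    qed
    then have eq: "1 / L * norm (y n) = norm (Phi y (E x))" using L by (simp add: norm_mult norm_divide)
    show ?thesis
      unfolding eq dual_norm_def
    proof (rule cSup_upper)
      show "norm (Phi y (E x)) \<in> {norm (Phi y f) |f. f \<in> lab a b p \<and> lab_norm a b p f \<le> 1}"
        using le1 E_in_lab[OF x] by blast
      \<comment> \<open>Only for a set bounded above does \<open>Sup\<close> dominate the
        elements.\<close>
      have "norm (Phi y f) \<le> K * lp_sum q y powr (1 / q)"
        if f: "f \<in> lab a b p" "lab_norm a b p f \<le> 1" for f
      proof -
        obtain x where x: "in_lp p x" "f = E x" using f(1) by (rule lab_obtain)
        have "norm (Phi y f) \<le> K * lp_sum q y powr (1 / q) * lab_norm a b p f"
          using K(2)[OF x(1) y] x by simp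
        also have "\<dots> \<le> K * lp_sum q y powr (1 / q) * 1"
          using K(1) f(2) by (intro mult_left_mono) auto
        finally show ?thesis by simp
      qed
      then show "bdd_above {norm (Phi y f) |f. f \<in> lab a b p \<and> lab_norm a b p f \<le> 1}"
        by (intro bdd_aboveI[where M = "K * lp_sum q y powr (1 / q)"]) auto
    qed
  qed
  then show thesis using that[of "1 / L"] L(1) by simp
qed

text \<open>Riesz representation: \<open>y\<close> collects the values on unit sequences, the
  extremal sequences of Hoelder's inequality show that it has exponent q, and continuity extends the
  formula from finite sections to all x.\<close>

lemma dual_representation:
  assumes phi: "\<phi> \<in> lab_dual a b p"
  obtains y where "in_lp q y" "\<phi> = Phi y"
proof -
  have p0: "0 \<le> p" using p by simp
  have add: "\<phi> (\<lambda>z. f z + g z) = \<phi> f + \<phi> g" if "f \<in> lab a b p" "g \<in> lab a b p" for f g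
    using phi that unfolding lab_dual_def by blast
  have cmult: "\<phi> (\<lambda>z. k * f z) = k * \<phi> f" if "f \<in> lab a b p" for k f
    using phi that unfolding lab_dual_def by blast
  have off: "\<phi> f = 0" if "f \<notin> lab a b p" for f
    using phi that unfolding lab_dual_def by blast
  obtain C where C: "\<And>f. f \<in> lab a b p \<Longrightarrow> norm (\<phi> f) \<le> C * lab_norm a b p f"
    using phi unfolding lab_dual_def by blast
  obtain K where K: "0 < K"
    "\<And>x. in_lp p x \<Longrightarrow> lab_norm a b p (E x) \<le> K * lp_sum p x powr (1 / p)"
    "\<And>x. in_lp p x \<Longrightarrow> lp_sum p x powr (1 / p) \<le> K * lab_norm a b p (E x)"
    using lab_norm_equiv by blast
  \<comment> \<open>The definition of \<open>lab_dual\<close> puts no sign on C, hence the absolute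
    value.\<close>
  define D where "D = \<bar>C\<bar> * K"
  have D0: "0 \<le> D" using K by (simp add: D_def)
  have D: "norm (\<phi> (E x)) \<le> D * lp_sum p x powr (1 / p)" if x: "in_lp p x" for x
  proof -
    have nn: "0 \<le> lab_norm a b p (E x)" by (simp add: lab_norm_def)
    have "norm (\<phi> (E x)) \<le> C * lab_norm a b p (E x)" by (rule C[OF E_in_lab[OF x]])
    also have "\<dots> \<le> \<bar>C\<bar> * lab_norm a b p (E x)" by (intro mult_right_mono nn) auto
    also have "\<dots> \<le> \<bar>C\<bar> * (K * lp_sum p x powr (1 / p))" by (intro mult_left_mono K(2,3) x) auto
    finally show ?thesis by (simp add: D_def mult_ac)
  qed
  define y where "y n = \<phi> (E (unit_seq n))" for n
  define head where "head x N i = (if i < N then x i else 0)" for x :: "nat \<Rightarrow> complex" and N i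
  have in_head: "in_lp p (head x N)" for x N
    by (rule in_lp_finite_support(1)[of N]) (simp add: head_def)
  have head: "\<phi> (E (head x N)) = (\<Sum>n<N. y n * x n)" for x N
  proof (induction N)
    case 0
    have "head x 0 = (\<lambda>i. 0)" by (simp add: head_def fun_eq_iff)
    then have "E (head x 0) = (\<lambda>z. 0 * E (head x 0) z)" by (simp add: E_zero)
    then show ?case using cmult[OF E_in_lab[OF in_head], of 0 x 0] by simp
  next
    case (Suc N)
    have "head x (Suc N) = (\<lambda>i. head x N i + x N * unit_seq N i)"
      by (auto simp: head_def unit_seq_def fun_eq_iff less_Suc_eq)
    then have "E (head x (Suc N)) = (\<lambda>z. E (head x N) z + E (\<lambda>i. x N * unit_seq N i) z)"
      by (simp add: E_add in_head in_lp_cmult in_lp_unit_seq p0)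
    then have "\<phi> (E (head x (Suc N))) = \<phi> (E (head x N)) + \<phi> (E (\<lambda>i. x N * unit_seq N i))"
      by (simp add: add E_in_lab in_head in_lp_cmult in_lp_unit_seq p0)
    also have "\<phi> (E (\<lambda>i. x N * unit_seq N i)) = x N * y N"
      by (simp add: E_cmult in_lp_unit_seq cmult E_in_lab y_def)
    finally show ?case using Suc by (simp add: mult.commute)
  qed
  have "(\<Sum>n<N. norm (y n) powr q) \<le> D powr q" for N
  proof -
    let ?S = "\<Sum>n<N. norm (y n) powr q"
    \<comment> \<open>The equality case of Hoelder: as \<open>(q - 1) * p = q\<close>, both
      \<open>y n * x n\<close> and \<open>norm (x n) powr p\<close> equal
      \<open>norm (y n) powr q\<close>. The N-th section then gives
      \<open>?S \<le> D * ?S powr (1 / p)\<close>, that is, \<open>?S powr (1 / q) \<le> D\<close>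
      unless \<open>?S\<close> vanishes.\<close>
    define x where "x n = cnj (y n) * of_real (norm (y n) powr (q - 2))" for n
    have yx: "y n * x n = of_real (norm (y n) powr q)" for n
    proof (cases "y n = 0")
      case False
      have "y n * x n = of_real ((norm (y n))\<^sup>2 * norm (y n) powr (q - 2))"
        by (simp only: of_real_mult complex_norm_square x_def mult.assoc)
      also have "(norm (y n))\<^sup>2 * norm (y n) powr (q - 2) = norm (y n) powr q"
        using False powr_add[of "norm (y n)" 2 "q - 2"] by simp
      finally show ?thesis .
    qed simp
    have xp: "norm (x n) powr p = norm (y n) powr q" for n
    proof (cases "y n = 0")
      case False
      have "norm (x n) = norm (y n) powr (q - 1)"
        using False powr_add[of "norm (y n)" 1 "q - 2"] by (simp add: x_def norm_mult)
      moreover have "(q - 1) * p = q" using pq p q by (simp add: field_simps)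
      ultimately show ?thesis by (simp add: powr_powr)
    qed (simp add: x_def)
    have S0: "0 \<le> ?S" by (intro sum_nonneg) auto
    have "\<phi> (E (head x N)) = of_real ?S" by (simp add: head yx)
    moreover have "lp_sum p (head x N) = ?S"
      using in_lp_finite_support(2)[of N "head x N" p] by (simp add: head_def xp)
    ultimately have "norm (complex_of_real ?S) \<le> D * ?S powr (1 / p)"
      using D[OF in_head, of x N] by metis
    then have le: "?S \<le> D * ?S powr (1 / p)"
      by (simp only: norm_of_real abs_of_nonneg[OF S0])
    show ?thesis
    proof (cases "?S = 0")
      case False
      then have S: "0 < ?S" using S0 by simp
      have "?S powr (1 / q) * ?S powr (1 / p) \<le> D * ?S powr (1 / p)"
        using le S pq by (simp add: add.commute flip: powr_add)
      then have "?S powr (1 / q) \<le> D" using S by simp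
      then have "(?S powr (1 / q)) powr q \<le> D powr q" using q by (intro powr_mono2) auto
      then show ?thesis using S q by (simp add: powr_powr)
    qed simp
  qed
  then have y: "in_lp q y" by (rule in_lp_of_partial_sums)
  have "\<phi> f = Phi y f" for f
  proof (cases "f \<in> lab a b p")
    case True
    then obtain x where x: "in_lp p x" "f = E x" by (rule lab_obtain)
    \<comment> \<open>The remainder after the N-th section tends to 0 in norm, and so does its value
      under \<phi>.\<close>
    define tail where "tail N = (\<lambda>i. if i < N then 0 else x i)" for N
    have in_tail: "in_lp p (tail N)" for N
      unfolding tail_def by (rule lp_tail(1)[OF x(1)])
    have split: "\<phi> f - (\<Sum>n<N. y n * x n) = \<phi> (E (tail N))" for N
    proof -
      have "x = (\<lambda>i. head x N i + tail N i)" by (auto simp: head_def tail_def)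
      then have "E x = (\<lambda>z. E (head x N) z + E (tail N) z)"
        using E_add[OF in_head in_tail] by metis
      then show ?thesis using add[OF E_in_lab[OF in_head] E_in_lab[OF in_tail]] head x(2) by simp
    qed
    have "(\<lambda>N. lp_sum p (tail N) powr (1 / p)) \<longlonglongrightarrow> 0 powr (1 / p)"
      using lp_tail_tendsto[OF x(1)] p lp_sum_nonneg[OF in_tail]
      by (intro tendsto_powr') (auto simp: tail_def)
    then have "(\<lambda>N. D * lp_sum p (tail N) powr (1 / p)) \<longlonglongrightarrow> D * 0"
      by (intro tendsto_mult tendsto_const) simp
    then have lim: "(\<lambda>N. D * lp_sum p (tail N) powr (1 / p)) \<longlonglongrightarrow> 0" by simp
    have "(\<lambda>N. \<phi> f - (\<Sum>n<N. y n * x n)) \<longlonglongrightarrow> 0"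
      by (rule Lim_null_comparison[OF _ lim]) (simp add: split D in_tail)
    moreover have "(\<lambda>N. \<phi> f - (\<Sum>n<N. y n * x n)) \<longlonglongrightarrow> \<phi> f - (\<Sum>n. y n * x n)"
      by (intro tendsto_diff tendsto_const summable_LIMSEQ Holder(1) x y)
    ultimately have "\<phi> f - (\<Sum>n. y n * x n) = 0" by (rule LIMSEQ_unique[symmetric])
    then show ?thesis using x by (simp add: Phi_E)
  qed (simp add: off Phi_def)
  then show thesis using that[OF y] by blast
qed

text \<open>The shift crosses the pairing by a change of index; no boundary term arises because
  \<open>wshift\<close> starts with 0.\<close>

lemma fwd_adj_Phi:
  assumes y: "in_lp q y" and M: "\<And>n. norm (w n * a n / a (Suc n)) \<le> M"
  shows "in_lp q (\<lambda>n. w n * a n / a (Suc n) * y (Suc n))"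
    and "fwd_adj a b w p (Phi y) = Phi (\<lambda>n. w n * a n / a (Suc n) * y (Suc n))"
proof -
  let ?u = "\<lambda>n. w n * a n / a (Suc n)"
  have "0 \<le> M" using M[of 0] norm_ge_zero order_trans by blast
  moreover have "norm (?u n * y (Suc n)) \<le> M * norm (y (Suc n))" for n
    unfolding norm_mult[of "?u n"] by (intro mult_right_mono M) auto
  ultimately show "in_lp q (\<lambda>n. ?u n * y (Suc n))"
    using y q by (intro in_lp_mono(1)[where x = "\<lambda>n. ?u n * y (Suc n)" and y = "\<lambda>n. y (Suc n)"])
      (auto simp: in_lp_Suc_iff)
  show "fwd_adj a b w p (Phi y) = Phi (\<lambda>n. ?u n * y (Suc n))"
  proof
    fix f
    show "fwd_adj a b w p (Phi y) f = Phi (\<lambda>n. ?u n * y (Suc n)) f"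
    proof (cases "f \<in> lab a b p")
      case True
      then obtain x where x: "in_lp p x" "f = E x" by (rule lab_obtain)
      have sx: "in_lp p (wshift ?u x)" using x(1) M by (rule in_lp_wshift)
      have "(\<Sum>n. y n * wshift ?u x n) = (\<Sum>n. y (Suc n) * wshift ?u x (Suc n))"
        using suminf_split_head[OF Holder(1)[OF sx y]] by (simp add: wshift_def)
      also have "\<dots> = (\<Sum>n. ?u n * y (Suc n) * x n)" by (simp add: wshift_def mult_ac)
      finally show ?thesis
        using True x sx by (simp only: fwd_adj_def fwd_shift_E[OF x(1) M] Phi_E if_True)
    qed (simp add: fwd_adj_def Phi_def)
  qed
qed

end

subsection \<open>The adjoint as an unweighted backward shift\<close>

locale lab_shift = lab_dual_space +
  fixes w :: "nat \<Rightarrow> complex"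
  assumes w_nz: "\<And>n. w n \<noteq> 0"
    and w_bdd: "bdd_above (range (\<lambda>n. norm (w n * a n / a (Suc n))))"
begin

text \<open>Chosen so that \<open>rho_Suc\<close> holds: dividing the coordinates by
  \<open>rho\<close> turns the weights of the backward shift into 1.\<close>

definition rho :: "nat \<Rightarrow> complex" where
  "rho n = a n / (\<Prod>k<n. w k)"

abbreviation admissible :: "(nat \<Rightarrow> complex) \<Rightarrow> bool" where
  "admissible t \<equiv> in_lp q (\<lambda>n. rho n * t n)"

abbreviation weight_sum :: "(nat \<Rightarrow> complex) \<Rightarrow> real" where
  "weight_sum t \<equiv> lp_sum q (\<lambda>n. rho n * t n)"

definition G :: "(nat \<Rightarrow> complex) \<Rightarrow> (complex \<Rightarrow> complex) \<Rightarrow> complex" where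
  "G t = Phi (\<lambda>n. rho n * t n)"

section \<open>Conjugacy with the unweighted backward shift\<close>

lemma rho_nz: "rho n \<noteq> 0"
  using a_nz w_nz by (simp add: rho_def)

lemma weight_bounded:
  obtains M where "1 \<le> M" "\<And>n. norm (w n * a n / a (Suc n)) \<le> M"
proof -
  obtain M where "\<And>n. norm (w n * a n / a (Suc n)) \<le> M"
    using w_bdd unfolding bdd_above_def by auto
  then show thesis using that[of "max 1 M"] by (meson max.cobounded1 max.coboundedI2)
qed

lemma rho_Suc: "w n * a n / a (Suc n) * rho (Suc n) = rho n"
  using a_nz[of "Suc n"] w_nz by (simp add: rho_def field_simps)

text \<open>The sum in condition (iii) starts at n = 1; adding the term of \<open>rho 0\<close> does
  not affect convergence.\<close>

lemma rho_summable_iff: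
  "summable (\<lambda>n. norm (a (Suc n) / (\<Prod>k\<le>n. w k)) powr q) \<longleftrightarrow> in_lp q rho"
  using in_lp_Suc_iff[of q rho] by (simp add: in_lp_def rho_def lessThan_Suc_atMost)

lemma dual_eq_G:
  assumes "\<phi> \<in> lab_dual a b p"
  obtains t where "admissible t" "\<phi> = G t"
proof -
  obtain y where y: "in_lp q y" "\<phi> = Phi y" using assms by (rule dual_representation)
  have "(\<lambda>n. rho n * (y n / rho n)) = y" using rho_nz by auto
  then show thesis using that[of "\<lambda>n. y n / rho n"] y by (simp add: G_def)
qed

lemma G_in_dual: "admissible t \<Longrightarrow> G t \<in> lab_dual a b p"
  unfolding G_def by (rule Phi_in_dual)

lemma G_inject:
  assumes "G t = G t'"
  shows "t = t'"
proof
  show "t n = t' n" for n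
    using fun_cong[OF Phi_inject[OF assms[unfolded G_def]], of n] rho_nz[of n] by simp
qed

lemma fwd_adj_G:
  assumes "admissible t"
  shows "admissible (\<lambda>n. t (Suc n))" "fwd_adj a b w p (G t) = G (\<lambda>n. t (Suc n))"
proof -
  obtain M where M: "\<And>n. norm (w n * a n / a (Suc n)) \<le> M" using weight_bounded by blast
  have eq: "w n * a n / a (Suc n) * (rho (Suc n) * t (Suc n)) = rho n * t (Suc n)" for n
    by (simp only: rho_Suc flip: mult.assoc)
  show "admissible (\<lambda>n. t (Suc n))" "fwd_adj a b w p (G t) = G (\<lambda>n. t (Suc n))"
    using fwd_adj_Phi[OF assms M] by (simp_all only: G_def eq)
qed

lemma fwd_adj_funpow_G:
  assumes "admissible t"
  shows "admissible (\<lambda>n. t (n + k))" "(fwd_adj a b w p ^^ k) (G t) = G (\<lambda>n. t (n + k))"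
proof -
  have "admissible (\<lambda>n. t (n + k)) \<and> (fwd_adj a b w p ^^ k) (G t) = G (\<lambda>n. t (n + k))"
  proof (induction k)
    case (Suc k)
    then show ?case using fwd_adj_G[of "\<lambda>n. t (n + k)"] by simp
  qed (simp add: assms)
  then show "admissible (\<lambda>n. t (n + k))" "(fwd_adj a b w p ^^ k) (G t) = G (\<lambda>n. t (n + k))"
    by simp_all
qed

section \<open>Weighted sums and approximation in the dual\<close>

lemma admissible_diff: "admissible t \<Longrightarrow> admissible s \<Longrightarrow> admissible (\<lambda>n. t n - s n)"
  using in_lp_diff[of q "\<lambda>n. rho n * t n" "\<lambda>n. rho n * s n"] q by (simp add: right_diff_distrib)

lemma weight_sum_add:
  assumes "admissible t" "admissible s"
  shows "admissible (\<lambda>n. t n + s n)"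
    and "weight_sum (\<lambda>n. t n + s n) \<le> 2 powr q * (weight_sum t + weight_sum s)"
  using in_lp_add[OF assms] q by (simp_all add: distrib_left)

lemma weight_sum_tail_tendsto:
  assumes "admissible t"
  shows "(\<lambda>N. weight_sum (\<lambda>n. if n < N then 0 else t n)) \<longlonglongrightarrow> 0"
    and "admissible (\<lambda>n. if n < N then 0 else t n)"
  using lp_tail_tendsto[OF assms] lp_tail(1)[OF assms, of N] by (simp_all add: if_distrib cong: if_cong)

lemma weight_sum_le_bound:
  assumes "in_lp q rho" "\<And>n. norm (t n) \<le> C" "0 \<le> C"
  shows "admissible t" "weight_sum t \<le> C powr q * lp_sum q rho"
  using assms q in_lp_mono[OF assms(1), of "\<lambda>n. rho n * t n" C]
  by (simp_all add: norm_mult mult_right_mono mult.commute)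

text \<open>Reduces approximation in the dual norm to approximation in \<open>weight_sum\<close>;
  \<open>(e / K) powr q\<close> undoes the bound by K times a q-th root.\<close>

lemma dual_dist_G_small:
  assumes "0 < e"
  obtains d where "0 < d" "\<And>t s. admissible t \<Longrightarrow> admissible s \<Longrightarrow>
    weight_sum (\<lambda>n. t n - s n) < d \<Longrightarrow> dual_dist a b p (G t) (G s) < e"
proof -
  obtain K where K: "0 < K"
    "\<And>y. in_lp q y \<Longrightarrow> dual_norm a b p (Phi y) \<le> K * lp_sum q y powr (1 / q)"
    using dual_norm_Phi_le by blast
  show thesis
  proof (rule that[of "(e / K) powr q"])
    show "0 < (e / K) powr q" using assms K by simp
    fix t s assume ts: "admissible t" "admissible s"
      and lt: "weight_sum (\<lambda>n. t n - s n) < (e / K) powr q"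
    note diff = admissible_diff[OF ts]
    have "dual_dist a b p (G t) (G s) = dual_norm a b p (Phi (\<lambda>n. rho n * (t n - s n)))"
      unfolding dual_dist_def G_def Phi_diff[OF ts] by (simp add: right_diff_distrib)
    also have "\<dots> \<le> K * weight_sum (\<lambda>n. t n - s n) powr (1 / q)"
      by (rule K(2)[OF diff])
    also have "\<dots> < K * ((e / K) powr q) powr (1 / q)"
      using K q lt lp_sum_nonneg[OF diff] by (intro mult_strict_left_mono powr_less_mono2) auto
    also have "\<dots> = e" using K q assms by (simp add: powr_powr)
    finally show "dual_dist a b p (G t) (G s) < e" .
  qed
qed

text \<open>The first N entries of \<open>s\<close> are followed by zeros and repeated with period
  P. The error is the tail of \<open>s\<close> beyond N plus the repetitions beyond P, and both are
  small once N and then P are large.\<close>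

lemma periodic_dense:
  assumes rho: "in_lp q rho" and y: "y \<in> lab_dual a b p" and e: "0 < e"
  obtains v where "v \<in> lab_dual a b p" "periodic_pt (fwd_adj a b w p) v" "dual_dist a b p v y < e"
proof -
  obtain s where s: "admissible s" "y = G s" using y by (rule dual_eq_G)
  obtain d where d: "0 < d" "\<And>t s. admissible t \<Longrightarrow> admissible s \<Longrightarrow>
    weight_sum (\<lambda>n. t n - s n) < d \<Longrightarrow> dual_dist a b p (G t) (G s) < e"
    using dual_dist_G_small[OF e] by blast
  \<comment> \<open>Half of \<open>d\<close> for each error, after paying the factor
    \<open>2 powr q\<close> of \<open>weight_sum_add\<close>.\<close>
  define d' where "d' = d / (2 * 2 powr q)"
  have d': "0 < d'" "2 powr q * (2 * d') = d" using d(1) by (auto simp: d'_def)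
  obtain N where N: "weight_sum (\<lambda>n. if n < N then 0 else - s n) < d'"
  proof -
    have "admissible (\<lambda>n. - s n)" using admissible_diff[of "\<lambda>n. 0" s] s(1)
      in_lp_finite_support(1)[of 0 "\<lambda>n. 0" q] by simp
    from order_tendstoD(2)[OF weight_sum_tail_tendsto(1)[OF this] d'(1)] show thesis
      using that by (auto simp: eventually_sequentially)
  qed
  \<comment> \<open>A bound for the repeated entries that does not depend on P, so that P can be
    chosen afterwards.\<close>
  define C where "C = (\<Sum>i<N. norm (s i))"
  have C: "0 \<le> C" by (simp add: C_def sum_nonneg)
  have "(\<lambda>P. C powr q * weight_sum (\<lambda>n. if n < P then 0 else 1)) \<longlonglongrightarrow> C powr q * 0"
    using weight_sum_tail_tendsto(1)[of "\<lambda>n. 1"] rho by (intro tendsto_mult tendsto_const) simp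
  then have "\<forall>\<^sub>F P in sequentially. C powr q * weight_sum (\<lambda>n. if n < P then 0 else 1) < d'"
    using d'(1) by (intro order_tendstoD(2)) auto
  then have "\<forall>\<^sub>F P in sequentially. N < P \<and>
      C powr q * weight_sum (\<lambda>n. if n < P then 0 else 1) < d'"
    using eventually_gt_at_top[of N] by eventually_elim auto
  then obtain P where P: "N < P" "C powr q * weight_sum (\<lambda>n. if n < P then 0 else 1) < d'"
    by (auto simp: eventually_sequentially)
  define t where "t n = (if n mod P < N then s (n mod P) else 0)" for n
  have tC: "norm (t n) \<le> C" for n
    using C by (auto simp: t_def C_def intro!: member_le_sum[of _ _ "\<lambda>i. norm (s i)"])
  have t: "admissible t" using rho tC C by (rule weight_sum_le_bound(1))
  let ?t1 = "\<lambda>n. if n < P then 0 else t n" and ?s1 = "\<lambda>n. if n < N then 0 else - s n"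
  have "weight_sum ?t1 \<le> C powr q * weight_sum (\<lambda>n. if n < P then 0 else 1)"
    using q C weight_sum_tail_tendsto(2)[of "\<lambda>n. 1" P] rho tC
    by (intro in_lp_mono(2)) (auto simp: norm_mult mult_right_mono mult.commute)
  then have t1: "weight_sum ?t1 < d'" using P(2) by simp
  have adm: "admissible ?t1" "admissible ?s1"
    using weight_sum_tail_tendsto(2)[OF t] weight_sum_tail_tendsto(2)[of "\<lambda>n. - s n" N]
      admissible_diff[of "\<lambda>n. 0" s] s(1) in_lp_finite_support(1)[of 0 "\<lambda>n. 0" q] by auto
  have "(\<lambda>n. rho n * (t n - s n)) = (\<lambda>n. rho n * (?t1 n + ?s1 n))"
    using P(1) by (auto simp: fun_eq_iff t_def)
  then have "weight_sum (\<lambda>n. t n - s n) = weight_sum (\<lambda>n. ?t1 n + ?s1 n)"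
    by (rule arg_cong)
  also have "\<dots> \<le> 2 powr q * (weight_sum ?t1 + weight_sum ?s1)"
    by (rule weight_sum_add(2)[OF adm])
  also have "\<dots> < 2 powr q * (2 * d')" using t1 N by (intro mult_strict_left_mono) auto
  finally have "dual_dist a b p (G t) (G s) < e" using d'(2) d(2)[OF t s(1)] by simp
  moreover have "t (n + P) = t n" for n by (simp add: t_def)
  then have "(fwd_adj a b w p ^^ P) (G t) = G t"
    unfolding fwd_adj_funpow_G(2)[OF t] by simp
  then have "periodic_pt (fwd_adj a b w p) (G t)"
    unfolding periodic_pt_def using P(1) by (intro exI[of _ P]) auto
  ultimately show thesis using that[OF G_in_dual[OF t]] s(2) by simp
qed

text \<open>Read from \<open>pos k\<close> on, the concatenated sequence is within
  \<open>(1 / 2) ^ k\<close> of \<open>W k\<close> in \<open>weight_sum\<close>, and words of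
  arbitrarily large index approximate any target.\<close>

lemma hypercyclic:
  assumes rho: "in_lp q rho"
  shows "hypercyclic_on (lab_dual a b p) (dual_dist a b p) (fwd_adj a b w p)"
proof -
  obtain W :: "nat \<Rightarrow> nat \<Rightarrow> complex" and len B where len: "\<And>k i. len k \<le> i \<Longrightarrow> W k i = 0"
    and B: "\<And>k i. norm (W k i) \<le> B k"
    and dense: "\<And>s N e r. 0 < e \<Longrightarrow> \<exists>k\<ge>r. len k = N \<and> (\<forall>i<N. norm (W k i - s i) < e)"
    using dense_words by metis
  have "\<exists>t pos. pos 0 = (0 :: nat) \<and>
    (\<forall>k I. (\<Sum>i<I. norm (t (i + pos k) - W k i) powr q * norm (rho i) powr q) \<le> (1 / 2) ^ k)"
    by (rule sparse_concatenation[where len = len and B = B])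
      (use len B q in_lp_summable[OF rho] in simp_all)
  then obtain t pos where pos: "pos 0 = (0 :: nat)"
    and est: "\<And>k I. (\<Sum>i<I. norm (t (i + pos k) - W k i) powr q * norm (rho i) powr q) \<le> (1 / 2) ^ k"
    by blast
  have est': "admissible (\<lambda>i. t (i + pos k) - W k i)"
    "weight_sum (\<lambda>i. t (i + pos k) - W k i) \<le> (1 / 2) ^ k" for k
    using est[of k] in_lp_of_partial_sums[of "\<lambda>i. rho i * (t (i + pos k) - W k i)" q "(1 / 2) ^ k"]
    by (simp_all add: norm_mult powr_mult mult.commute)
  have W: "admissible (W k)" for k
    by (rule in_lp_finite_support(1)[of "len k"]) (simp add: len)
  \<comment> \<open>As \<open>pos 0 = 0\<close>, the estimate at k = 0 compares \<open>t\<close>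
    itself with the admissible word \<open>W 0\<close>.\<close>
  have t: "admissible t"
    using weight_sum_add(1)[OF est'(1)[of 0] W[of 0]] by (simp add: pos)
  show ?thesis
    unfolding hypercyclic_on_def
  proof (intro bexI[of _ "G t"] ballI allI impI)
    show "G t \<in> lab_dual a b p" by (rule G_in_dual[OF t])
    fix y and e :: real assume y: "y \<in> lab_dual a b p" and e: "0 < e"
    obtain s where s: "admissible s" "y = G s" using y by (rule dual_eq_G)
    obtain d where d: "0 < d" "\<And>t s. admissible t \<Longrightarrow> admissible s \<Longrightarrow>
      weight_sum (\<lambda>n. t n - s n) < d \<Longrightarrow> dual_dist a b p (G t) (G s) < e"
      using dual_dist_G_small[OF e] by blast
    define c2 where "c2 = (2 :: real) powr q"
    have c2: "0 < c2" by (simp add: c2_def)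
    \<comment> \<open>Two triangle inequalities are nested, each with factor \<open>c2\<close> and
      two errors: \<open>d1\<close> bounds the distances of \<open>W k\<close> to the shifted
      \<open>t\<close> and to \<open>s\<close>, \<open>d2\<close> the head and the tail of
      \<open>W k - s\<close>.\<close>
    define d1 where "d1 = d / (2 * c2)"
    define d2 where "d2 = d1 / (2 * c2)"
    have d1: "0 < d1" "c2 * (2 * d1) = d" using d(1) c2 by (auto simp: d1_def)
    have d2: "0 < d2" "c2 * (2 * d2) = d1" using d1(1) c2 by (auto simp: d2_def)
    have ms: "admissible (\<lambda>n. - s n)" using admissible_diff[of "\<lambda>n. 0" s] s(1)
      in_lp_finite_support(1)[of 0 "\<lambda>n. 0" q] by simp
    obtain N where N: "weight_sum (\<lambda>n. if n < N then 0 else - s n) < d2"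
      using order_tendstoD(2)[OF weight_sum_tail_tendsto(1)[OF ms] d2(1)]
      by (auto simp: eventually_sequentially)
    \<comment> \<open>The accuracy on the first N entries; the \<open>+ 1\<close> avoids division by
      0 and leaves \<open>h powr q * lp_sum q rho\<close> strictly below \<open>d2\<close>.\<close>
    define h where "h = (d2 / (lp_sum q rho + 1)) powr (1 / q)"
    have R: "0 \<le> lp_sum q rho" by (rule lp_sum_nonneg[OF rho])
    have h: "0 < h" using d2(1) R by (simp add: h_def)
    have "h powr q = d2 / (lp_sum q rho + 1)" using d2(1) R q by (simp add: h_def powr_powr)
    then have "h powr q * lp_sum q rho + h powr q = d2" using R by (simp add: field_simps)
    moreover have "0 < h powr q" using h by simp
    ultimately have hq: "h powr q * lp_sum q rho < d2" by linarith
    obtain r where r: "(1 / 2) ^ r < d1" using real_arch_pow_inv[OF d1(1), of "1 / 2"] by auto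
    obtain k where k: "r \<le> k" "len k = N" "\<And>i. i < N \<Longrightarrow> norm (W k i - s i) < h"
      using dense[OF h, of r N s] by auto
    let ?h1 = "\<lambda>n. if n < N then W k n - s n else 0" and ?h2 = "\<lambda>n. if n < N then 0 else - s n"
    have h1: "admissible ?h1" "weight_sum ?h1 < d2"
      using weight_sum_le_bound[OF rho, of ?h1 h] k(3) h hq by (auto simp: less_imp_le)
    have "(\<lambda>n. rho n * (W k n - s n)) = (\<lambda>n. rho n * (?h1 n + ?h2 n))"
      using len[of k] k(2) by (auto simp: fun_eq_iff)
    then have "weight_sum (\<lambda>n. W k n - s n) = weight_sum (\<lambda>n. ?h1 n + ?h2 n)"
      by (rule arg_cong)
    also have "\<dots> \<le> c2 * (weight_sum ?h1 + weight_sum ?h2)"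
      unfolding c2_def by (rule weight_sum_add(2)[OF h1(1) weight_sum_tail_tendsto(2)[OF ms]])
    also have "\<dots> < c2 * (2 * d2)" using h1(2) N c2 by (intro mult_strict_left_mono) auto
    finally have Ws: "weight_sum (\<lambda>n. W k n - s n) < d1" using d2(2) by simp
    have "(1 / 2 :: real) ^ k \<le> (1 / 2) ^ r" using k(1) by (intro power_decreasing) auto
    then have tW: "weight_sum (\<lambda>n. t (n + pos k) - W k n) < d1" using est'(2)[of k] r by linarith
    have "weight_sum (\<lambda>n. t (n + pos k) - s n)
        = weight_sum (\<lambda>n. (t (n + pos k) - W k n) + (W k n - s n))" by simp
    also have "\<dots> \<le> c2 * (weight_sum (\<lambda>n. t (n + pos k) - W k n) + weight_sum (\<lambda>n. W k n - s n))"
      unfolding c2_def by (rule weight_sum_add(2)[OF est'(1) admissible_diff[OF W s(1)]])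
    also have "\<dots> < c2 * (2 * d1)" using Ws tW c2 by (intro mult_strict_left_mono) auto
    finally have "dual_dist a b p (G (\<lambda>n. t (n + pos k))) (G s) < e"
      using d1(2) by (intro d(2) fwd_adj_funpow_G t s(1)) simp
    then show "\<exists>n. dual_dist a b p ((fwd_adj a b w p ^^ n) (G t)) y < e"
      unfolding s(2) by (intro exI[of _ "pos k"]) (simp add: fwd_adj_funpow_G(2)[OF t])
  qed
qed

lemma chaotic:
  assumes "in_lp q rho"
  shows "chaotic_on (lab_dual a b p) (dual_dist a b p) (fwd_adj a b w p)"
  unfolding chaotic_on_def
proof (intro conjI ballI allI impI)
  fix y and e :: real assume "y \<in> lab_dual a b p" "0 < e"
  then show "\<exists>v\<in>lab_dual a b p. periodic_pt (fwd_adj a b w p) v \<and> dual_dist a b p v y < e"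
    by (rule periodic_dense[OF assms]) blast
qed (rule hypercyclic[OF assms])

text \<open>The functional of \<open>unit_seq 0\<close> has distance at least \<open>e\<close> from
  0, so a periodic vector closer to it than \<open>e\<close> is nonzero.\<close>

lemma chaotic_imp_periodic:
  assumes "chaotic_on (lab_dual a b p) (dual_dist a b p) (fwd_adj a b w p)"
  shows "\<exists>v\<in>lab_dual a b p. v \<noteq> (\<lambda>f. 0) \<and> periodic_pt (fwd_adj a b w p) v"
proof -
  obtain e where e: "0 < e" "\<And>y n. in_lp q y \<Longrightarrow> e * norm (y n) \<le> dual_norm a b p (Phi y)"
    using dual_norm_Phi_ge by blast
  have u: "in_lp q (unit_seq 0)" by (rule in_lp_unit_seq)
  obtain v where v: "v \<in> lab_dual a b p" "periodic_pt (fwd_adj a b w p) v"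
    "dual_dist a b p v (Phi (unit_seq 0)) < e"
    using assms Phi_in_dual[OF u] e(1) unfolding chaotic_on_def by blast
  have "v \<noteq> (\<lambda>f. 0)"
  proof
    assume "v = (\<lambda>f. 0)"
    then have "dual_dist a b p v (Phi (unit_seq 0)) = dual_norm a b p (Phi (\<lambda>n. 0 - unit_seq 0 n))"
      unfolding dual_dist_def using in_lp_finite_support(1)[of 0 "\<lambda>n. 0" q]
      by (subst Phi_diff[symmetric, OF _ u]) (simp_all add: Phi_zero)
    moreover have "in_lp q (\<lambda>n. 0 - unit_seq 0 n)"
      using in_lp_cmult[OF u, of "-1"] q by simp
    from e(2)[OF this, of 0] have "e \<le> dual_norm a b p (Phi (\<lambda>n. 0 - unit_seq 0 n))"
      by (simp add: unit_seq_def)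
    ultimately show False using v(3) by simp
  qed
  then show ?thesis using v by blast
qed

section \<open>From a nonzero periodic vector to summable weights\<close>

lemma rho_le:
  assumes "1 \<le> M" "\<And>n. norm (w n * a n / a (Suc n)) \<le> M"
  shows "norm (rho n) \<le> M ^ j * norm (rho (n + j))"
proof (induction j)
  case (Suc j)
  have "norm (rho (n + j)) \<le> M * norm (rho (Suc (n + j)))"
    using assms(2)[of "n + j"] rho_Suc[of "n + j"] by (metis mult_right_mono norm_ge_zero norm_mult)
  then have "M ^ j * norm (rho (n + j)) \<le> M ^ j * (M * norm (rho (Suc (n + j))))"
    using assms(1) by (intro mult_left_mono) auto
  with Suc show ?case by (simp add: mult_ac)
qed simp

text \<open>Every window of m indices starting at or beyond n0 contains one where \<open>t\<close>
  takes the nonzero value \<open>t n0\<close>. There \<open>rho * t\<close> controls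
  \<open>rho\<close>, and \<open>rho_le\<close> carries the bound back to the start of the
  window.\<close>

lemma periodic_imp_rho:
  assumes v: "v \<in> lab_dual a b p" "v \<noteq> (\<lambda>f. 0)" "periodic_pt (fwd_adj a b w p) v"
  shows "in_lp q rho"
proof -
  obtain t where t: "admissible t" "v = G t" using v(1) by (rule dual_eq_G)
  obtain m where m: "1 \<le> m" "(fwd_adj a b w p ^^ m) v = v"
    using v(3) unfolding periodic_pt_def by blast
  have "(\<lambda>n. t (n + m)) = t" using m(2) fwd_adj_funpow_G(2)[OF t(1)] G_inject t(2) by metis
  then have per: "t (n + m) = t n" for n by metis
  have per_mult: "t (n + m * k) = t n" for n k
  proof (induction k)
    case (Suc k)
    then show ?case using per[of "n + m * k"] by (simp add: add_ac)
  qed simp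
  have "\<exists>n0. t n0 \<noteq> 0"
  proof (rule ccontr)
    assume "\<not> ?thesis"
    then have "v = Phi (\<lambda>n. 0)" using t(2) by (simp add: G_def)
    then show False using v(2) Phi_zero by simp
  qed
  then obtain n0 where n0: "t n0 \<noteq> 0" by blast
  obtain M where M: "1 \<le> M" "\<And>n. norm (w n * a n / a (Suc n)) \<le> M"
    using weight_bounded by blast
  define C where "C = M ^ m / norm (t n0)"
  have C: "0 \<le> C" using M by (simp add: C_def)
  have hit: "\<exists>j<m. t (n + j) = t n0" if "n0 \<le> n" for n
  proof -
    \<comment> \<open>Here \<open>j\<close> is the distance from n up to the next index congruent to
      n0 modulo m.\<close>
    define r where "r = (n - n0) mod m"
    define j where "j = (if r = 0 then 0 else m - r)"
    have rm: "r < m" using m(1) by (simp add: r_def)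
    have "n - n0 = m * ((n - n0) div m) + r" by (simp add: r_def)
    then have "n + j = n0 + m * ((n - n0) div m + (if r = 0 then 0 else 1))"
      using that rm by (auto simp: j_def)
    then have "t (n + j) = t n0" using per_mult by metis
    then show ?thesis using m(1) rm by (intro exI[of _ j]) (auto simp: j_def)
  qed
  \<comment> \<open>Summing over all j < m frees the majorant from the dependence of j on n, leaving
    a finite sum of shifted convergent series.\<close>
  have bound: "norm (rho n) powr q \<le> (\<Sum>j<m. C powr q * norm (rho (n + j) * t (n + j)) powr q)"
    if n: "n0 \<le> n" for n
  proof -
    obtain j where j: "j < m" "t (n + j) = t n0" using hit[OF n] by blast
    have "norm (rho n) \<le> M ^ j * norm (rho (n + j))" using M by (rule rho_le)
    also have "\<dots> \<le> M ^ m * norm (rho (n + j))"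
      using M(1) j(1) by (intro mult_right_mono power_increasing) auto
    also have "\<dots> = C * norm (rho (n + j) * t (n + j))"
      using n0 by (simp add: C_def j(2) norm_mult)
    finally have "norm (rho n) powr q \<le> C powr q * norm (rho (n + j) * t (n + j)) powr q"
      using q C by (simp add: powr_mono2 flip: powr_mult)
    also have "\<dots> \<le> (\<Sum>j<m. C powr q * norm (rho (n + j) * t (n + j)) powr q)"
      using j(1)
      by (intro member_le_sum[of j _ "\<lambda>j. C powr q * norm (rho (n + j) * t (n + j)) powr q"]) auto
    finally show ?thesis .
  qed
  have "summable (\<lambda>n. \<Sum>j<m. C powr q * norm (rho (n + j) * t (n + j)) powr q)"
    by (intro summable_sum summable_mult summable_ignore_initial_segment in_lp_summable[OF t(1)])
  then show ?thesis
    unfolding in_lp_def by (rule summable_comparison_test'[where N = n0]) (use bound in auto)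
qed

end

theorem mainTheorem6:
  fixes a b w :: "nat \<Rightarrow> complex" and p q :: real
  assumes p: "1 < p" and pq: "1 / p + 1 / q = 1"
    and a_nz: "\<forall>n. a n \<noteq> 0" and b_nz: "\<forall>n. b n \<noteq> 0"
    and growth: "limsup (\<lambda>n. ereal ((norm (a n) + norm (b n)) powr (1 / real n))) < \<infinity>"
    and w_nz: "\<forall>n. w n \<noteq> 0"
    and w_bdd: "bdd_above (range (\<lambda>n. norm (w n * a n / a (Suc n))))"
    and ba_lim: "limsup (\<lambda>n. ereal (norm (b n / a (Suc n)))) < 1"
  defines "X \<equiv> lab_dual a b p"
    and "T \<equiv> fwd_adj a b w p"
    and "d \<equiv> dual_dist a b p"
  shows
    "(summable (\<lambda>n. norm (a (Suc n) / (\<Prod>k\<le>n. w k)) powr q) \<longrightarrow> chaotic_on X d T)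
     \<and> (chaotic_on X d T \<longrightarrow> (\<exists>v\<in>X. v \<noteq> (\<lambda>f. 0) \<and> periodic_pt T v))
     \<and> (((\<forall>n. summable (\<lambda>j. norm (\<Prod>k=1..Suc j. b (n + k - 1) / a (n + k)) powr p)) \<and>
          summable (\<lambda>n. (\<Sum>j. norm (\<Prod>k=1..Suc j. b (n + k - 1) / a (n + k)) powr p) powr (q / p)))
        \<longrightarrow> ((\<exists>v\<in>X. v \<noteq> (\<lambda>f. 0) \<and> periodic_pt T v) \<longrightarrow>
             summable (\<lambda>n. norm (a (Suc n) / (\<Prod>k\<le>n. w k)) powr q)))"
proof -
  interpret lab_shift a b p q w
    using p pq a_nz growth w_nz w_bdd ba_lim by unfold_locales auto
  show ?thesis
    unfolding X_def T_def d_def rho_summable_iff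
  proof (intro conjI impI)
    show "chaotic_on (lab_dual a b p) (dual_dist a b p) (fwd_adj a b w p)" if "in_lp q rho"
      using that by (rule chaotic)
    show "\<exists>v\<in>lab_dual a b p. v \<noteq> (\<lambda>f. 0) \<and> periodic_pt (fwd_adj a b w p) v"
      if "chaotic_on (lab_dual a b p) (dual_dist a b p) (fwd_adj a b w p)"
      using that by (rule chaotic_imp_periodic)
    show "in_lp q rho"
      if "\<exists>v\<in>lab_dual a b p. v \<noteq> (\<lambda>f. 0) \<and> periodic_pt (fwd_adj a b w p) v"
      using that by (blast intro: periodic_imp_rho)
  qed
qed

end
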